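(* Suppose the standing assumptions (A)-(C) in the context hold and that $\mathcal{A}$ is surjective. Let $\{x^k\}$ be generated by the Riemannian smoothing gradient method with epochs described in the context, applied to $\min_{x\in\mathcal{M}} f(x)+h(\mathcal{A}x)$ with tolerance $\epsilon>0$, and set $$\hat{x}^{k}=x^{k}-\mathcal{A}^{\dagger}\bigl(\mathcal{A}x^{k}-\mathrm{prox}_{\mu_{k}h}(\mathcal{A}x^{k})\bigr).$$ Then for some index $k'=O(\epsilon^{-3})$ (the implied constant not depending on $\epsilon$) one has $$\mathrm{dist}\Bigl(0,\ \mathcal{P}_{T_{x^{k'}}\mathcal{M}}\bigl(\nabla f(\hat{x}^{k'})+\mathcal{A}^{*}\partial h(\mathcal{A}\hat{x}^{k'})\bigr)\Bigr)\le\epsilon,\qquad \|x^{k'}-\hat{x}^{k'}\|\le\epsilon .$$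
   Context: Setting and standing assumptions. (A) $\mathcal{M}$ is a compact Riemannian submanifold embedded in $\mathbb{R}^n$ (with the Euclidean inner product on tangent spaces $T_x\mathcal{M}$); $\mathcal{P}_{T_x\mathcal{M}}$ is the orthogonal projection onto $T_x\mathcal{M}$. (B) $f$ is continuously differentiable on $\mathbb{R}^n$ with $\ell_{\nabla f}$-Lipschitz gradient $\nabla f$, not necessarily convex; $h:\mathbb{R}^m\to\mathbb{R}$ is $\rho$-weakly convex ($h+\frac{\rho}{2}\|\cdot\|^2$ is convex), with $\rho>0$, and $\ell_h$-Lipschitz continuous, not necessarily smooth; $\mathcal{A}:\mathbb{R}^n\to\mathbb{R}^m$ is linear (nonzero), with adjoint $\mathcal{A}^*$ and operator norm $\|\mathcal{A}\|$; $\varphi(x)=f(x)+h(\mathcal{A}x)$ is bounded from below. (C) $\mathcal{R}:T\mathcal{M}\to\mathcal{M}$ is a retraction (a smooth map whose restrictions $\mathcal{R}_x$ to $T_x\mathcal{M}$ satisfy $\mathcal{R}_x(0_x)=x$, $d\mathcal{R}_x(0_x)=\mathrm{id}$), and there are constants $\alpha,\beta>0$ with $\|\mathcal{R}_x(u)-x\|\le\alpha\|u\|$ and $\|\mathcal{R}_x(u)-x-u\|\le\beta\|u\|^2$ for all $x\in\mathcal{M}$, $u\in T_x\mathcal{M}$. Notation. $\partial h$ is the limiting subdifferential. For $\mu\in(0,\rho^{-1})$, $h_\mu(y)=\inf_z\{h(z)+\frac{1}{2\mu}\|z-y\|^2\}$ is the Moreau envelope and $\mathrm{prox}_{\mu h}(y)=\arg\min_z\{h(z)+\frac{1}{2\mu}\|z-y\|^2\}$.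 For parameters $\mu_k$, $F_k(x)=f(x)+h_{\mu_k}(\mathcal{A}x)$ and $\mathrm{grad}\,F_k(x)=\mathcal{P}_{T_x\mathcal{M}}(\nabla F_k(x))$. $G$ is a finite constant with $\|\nabla F_k(x)\|\le G$ for all $x\in\mathcal{M}$ and all $k\ge1$. $\mathrm{dist}(x,C)=\min_{y\in C}\|x-y\|$, and $\mathcal{P}_{T_x\mathcal{M}}(\nabla f(y)+\mathcal{A}^*\partial h(z))$ is the set $\{\mathcal{P}_{T_x\mathcal{M}}(\nabla f(y)+\mathcal{A}^*\zeta):\zeta\in\partial h(z)\}$. For surjective $\mathcal{A}$, $\mathcal{A}^\dagger=\mathcal{A}^*(\mathcal{A}\mathcal{A}^* )^{-1}$. Riemannian smoothing gradient method with epochs. Input $x^1\in\mathcal{M}$, $\epsilon>0$. For $l=0,1,2,\dots$: set $S_l\leftarrow\infty$, $k_l\leftarrow 2^l$; for $k=2^l,\dots,2^{l+1}-1$: set $\mu_k=(2\rho)^{-1}k^{-1/3}$, $\ell_k=\alpha^2\ell_{\nabla f}+\alpha^2\|\mathcal{A}\|^2\mu_k^{-1}+2G\beta$, $\gamma_k=1/\ell_k$, and $$x^{k+1}=\mathcal{R}_{x^k}(-\gamma_k\,\mathrm{grad}\,F_k(x^k));$$ if $\|\mathrm{grad}\,F_{k+1}(x^{k+1})\|\le S_l$, set $S_l\leftarrow\|\mathrm{grad}\,F_{k+1}(x^{k+1})\|$, $k_l\leftarrow k+1$, and, if moreover $S_l\le\epsilon$ and $\|x^{k+1}-\hat{x}^{k+1}\|\le\epsilon$,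 break. The stopping test only determines when the run is broken off; it does not influence the values of the iterates, and $\{x^k\}$ denotes the sequence given by the update rule. *)

theory Defs
  imports "HOL-Analysis.Analysis" "HOL-Library.Landau_Symbols"
begin

section \<open>Embedded submanifolds of Euclidean space\<close>

text \<open>In finite dimension a map is of class \<open>C\<^sup>k\<^sup>+\<^sup>1\<close> on an open set iff it is differentiable there
  and every directional derivative is of class \<open>C\<^sup>k\<close>. Only meaningful for open \<open>S\<close>.\<close>

primrec Ck_on :: "'a::euclidean_space set \<Rightarrow> ('a \<Rightarrow> 'b::euclidean_space) \<Rightarrow> nat \<Rightarrow> bool" where
  "Ck_on S g 0 \<longleftrightarrow> continuous_on S g"
| "Ck_on S g (Suc k) \<longleftrightarrow> (\<forall>x\<in>S. g differentiable (at x)) \<and>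
     (\<forall>v. Ck_on S (\<lambda>x. frechet_derivative g (at x) v) k)"

definition smooth_on :: "'a::euclidean_space set \<Rightarrow> ('a \<Rightarrow> 'b::euclidean_space) \<Rightarrow> bool" where
  "smooth_on S g \<longleftrightarrow> (\<forall>k. Ck_on S g k)"

text \<open>Smoothness of a map defined on an arbitrary subset of a Euclidean space: locally the map
  extends to a smooth map on an open set. For an embedded submanifold \<open>S\<close> this is the usual
  smoothness.\<close>

definition smooth_map_on :: "'a::euclidean_space set \<Rightarrow> ('a \<Rightarrow> 'b::euclidean_space) \<Rightarrow> bool" where
  "smooth_map_on S g \<longleftrightarrow>
     (\<forall>p\<in>S. \<exists>U g'. open U \<and> p \<in> U \<and> smooth_on U g' \<and> (\<forall>q\<in>S \<inter> U. g' q = g q))"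

text \<open>Slice charts: near each of its points, \<open>M\<close> is carried by a diffeomorphism between open sets of
  the ambient space onto an open piece of a fixed linear subspace \<open>L\<close>, whose dimension is that
  of \<open>M\<close>. The Riemannian metric is the restriction of the ambient inner product.\<close>

definition embedded_submanifold :: "'a::euclidean_space set \<Rightarrow> bool" where
  "embedded_submanifold M \<longleftrightarrow>
     (\<exists>L :: 'a set. subspace L \<and>
       (\<forall>x\<in>M. \<exists>U V \<Phi> \<Psi>. open U \<and> x \<in> U \<and> open V \<and>
          homeomorphism U V \<Phi> \<Psi> \<and> smooth_on U \<Phi> \<and> smooth_on V \<Psi> \<and>
          \<Phi> ` (M \<inter> U) = L \<inter> V))"

text \<open>Velocities at \<open>x\<close> of smooth curves in \<open>M\<close>, as vectors of the ambient space.\<close>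

definition tangent_space :: "'a::euclidean_space set \<Rightarrow> 'a \<Rightarrow> 'a set" where
  "tangent_space M x =
     {v. \<exists>\<delta>>0. \<exists>c::real \<Rightarrow> 'a. smooth_on {-\<delta><..<\<delta>} c \<and> c ` {-\<delta><..<\<delta>} \<subseteq> M \<and> c 0 = x \<and>
         (c has_vector_derivative v) (at 0)}"

definition tangent_bundle :: "'a::euclidean_space set \<Rightarrow> ('a \<times> 'a) set" where
  "tangent_bundle M = (SIGMA x:M. tangent_space M x)"

definition orth_proj :: "'a::euclidean_space set \<Rightarrow> 'a \<Rightarrow> 'a" where
  "orth_proj S v = (THE w. w \<in> S \<and> v - w \<in> S\<^sup>\<bottom>)"

lemma orth_proj_unique:
  assumes "subspace S" "w \<in> S" "v - w \<in> S\<^sup>\<bottom>"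
  shows "orth_proj S v = w"
  unfolding orth_proj_def
proof (rule the_equality)
  fix w' assume w': "w' \<in> S \<and> v - w' \<in> S\<^sup>\<bottom>"
  have "w - w' \<in> S" using assms w' by (auto intro: subspace_diff)
  moreover have "w - w' \<in> S\<^sup>\<bottom>"
    using subspace_diff[OF subspace_orthogonal_comp, of "v - w'" S "v - w"] assms w' by simp
  ultimately have "orthogonal (w - w') (w - w')" by (simp add: orthogonal_comp_def)
  then show "w' = w" by (simp add: orthogonal_self)
qed (use assms in auto)

text \<open>\<open>R x\<close> is the restriction of the retraction to the tangent space at \<open>x\<close>; values of \<open>R\<close> outside
  the tangent bundle are irrelevant. The derivative at \<open>0\<close> is taken within the tangent space.\<close>

definition manifold_retraction :: "'a::euclidean_space set \<Rightarrow> ('a \<Rightarrow> 'a \<Rightarrow> 'a) \<Rightarrow> bool" where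
  "manifold_retraction M R \<longleftrightarrow>
     (\<forall>x\<in>M. \<forall>u\<in>tangent_space M x. R x u \<in> M) \<and>
     smooth_map_on (tangent_bundle M) (\<lambda>(x, u). R x u) \<and>
     (\<forall>x\<in>M. R x 0 = x \<and> (R x has_derivative (\<lambda>u. u)) (at 0 within tangent_space M x))"


section \<open>Gradients, subdifferentials and the Moreau envelope\<close>

definition gradient :: "('a::euclidean_space \<Rightarrow> real) \<Rightarrow> 'a \<Rightarrow> 'a" where
  "gradient F x = (THE D. GDERIV F x :> D)"

lemma gradient_eqI:
  assumes "GDERIV F x :> D"
  shows "gradient F x = D"
  unfolding gradient_def
proof (rule the_equality[of "\<lambda>D. GDERIV F x :> D", OF assms])
  fix D' assume "GDERIV F x :> D'"
  then have "(\<lambda>v. v \<bullet> D') = (\<lambda>v. v \<bullet> D)"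
    using assms unfolding gderiv_def by (rule has_derivative_unique)
  then have "\<forall>v. v \<bullet> D' = v \<bullet> D" by (simp add: fun_eq_iff)
  then show "D' = D" by (simp only: vector_eq_ldot)
qed

definition riemannian_gradient :: "'a::euclidean_space set \<Rightarrow> ('a \<Rightarrow> real) \<Rightarrow> 'a \<Rightarrow> 'a" where
  "riemannian_gradient M F x = orth_proj (tangent_space M x) (gradient F x)"

definition weakly_convex :: "real \<Rightarrow> ('b::euclidean_space \<Rightarrow> real) \<Rightarrow> bool" where
  "weakly_convex \<rho> h \<longleftrightarrow> convex_on UNIV (\<lambda>y. h y + \<rho> / 2 * (norm y)\<^sup>2)"

definition frechet_subdifferential :: "('b::euclidean_space \<Rightarrow> real) \<Rightarrow> 'b \<Rightarrow> 'b set" where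
  "frechet_subdifferential h y =
     {v. 0 \<le> Liminf (at y) (\<lambda>z. ereal ((h z - h y - v \<bullet> (z - y)) / norm (z - y)))}"

definition limiting_subdifferential :: "('b::euclidean_space \<Rightarrow> real) \<Rightarrow> 'b \<Rightarrow> 'b set" where
  "limiting_subdifferential h y =
     {v. \<exists>Y V. Y \<longlonglongrightarrow> y \<and> (\<lambda>i. h (Y i)) \<longlonglongrightarrow> h y \<and>
            (\<forall>i::nat. V i \<in> frechet_subdifferential h (Y i)) \<and> V \<longlonglongrightarrow> v}"

text \<open>The following two are only meaningful when the infimum is finite and attained, e.g. for
  \<open>\<rho>\<close>-weakly convex \<open>h\<close> and \<open>0 < \<mu> < 1 / \<rho>\<close>.\<close>

definition moreau_envelope :: "('b::euclidean_space \<Rightarrow> real) \<Rightarrow> real \<Rightarrow> 'b \<Rightarrow> real" where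
  "moreau_envelope h \<mu> y = (INF z. h z + 1 / (2 * \<mu>) * (norm (z - y))\<^sup>2)"

definition prox :: "('b::euclidean_space \<Rightarrow> real) \<Rightarrow> real \<Rightarrow> 'b \<Rightarrow> 'b" where
  "prox h \<mu> y = (ARG_MIN (\<lambda>z. h z + 1 / (2 * \<mu>) * (norm (z - y))\<^sup>2) z. True)"

text \<open>Used for surjective \<open>A\<close> only, where \<open>A A\<^sup>*\<close> is bijective.\<close>

definition right_pinv :: "('a::euclidean_space \<Rightarrow> 'b::euclidean_space) \<Rightarrow> 'b \<Rightarrow> 'a" where
  "right_pinv A = adjoint A \<circ> inv (A \<circ> adjoint A)"


section \<open>The Riemannian smoothing gradient method with epochs\<close>

definition smoothing_param :: "real \<Rightarrow> nat \<Rightarrow> real" where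
  "smoothing_param \<rho> k = 1 / (2 * \<rho>) * real k powr (- 1 / 3)"

definition smoothed_objective ::
  "('a::euclidean_space \<Rightarrow> real) \<Rightarrow> ('b::euclidean_space \<Rightarrow> real) \<Rightarrow> ('a \<Rightarrow> 'b) \<Rightarrow> real \<Rightarrow>
   nat \<Rightarrow> 'a \<Rightarrow> real" where
  "smoothed_objective f h A \<rho> k x = f x + moreau_envelope h (smoothing_param \<rho> k) (A x)"

definition step_size ::
  "('a::euclidean_space \<Rightarrow> 'b::euclidean_space) \<Rightarrow> real \<Rightarrow> real \<Rightarrow> real \<Rightarrow> real \<Rightarrow> real \<Rightarrow>
   nat \<Rightarrow> real" where
  "step_size A \<rho> \<alpha> \<beta> Lf G k =
     1 / (\<alpha>\<^sup>2 * Lf + \<alpha>\<^sup>2 * (onorm A)\<^sup>2 * inverse (smoothing_param \<rho> k) + 2 * G * \<beta>)"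

text \<open>Iterates are indexed from \<open>1\<close>; the value \<open>x 0\<close> is irrelevant. The epochs
  \<open>{2 ^ l..2 ^ (l + 1) - 1}\<close> exhaust the positive indices. The stopping test and the record of the
  best iterate of an epoch do not influence the iterates and are not part of the recursion.\<close>

definition smoothing_gradient_iterates ::
  "'a::euclidean_space set \<Rightarrow> ('a \<Rightarrow> 'a \<Rightarrow> 'a) \<Rightarrow> ('a \<Rightarrow> real) \<Rightarrow> ('b::euclidean_space \<Rightarrow> real) \<Rightarrow>
   ('a \<Rightarrow> 'b) \<Rightarrow> real \<Rightarrow> real \<Rightarrow> real \<Rightarrow> real \<Rightarrow> real \<Rightarrow> (nat \<Rightarrow> 'a) \<Rightarrow> bool" where
  "smoothing_gradient_iterates M R f h A \<rho> \<alpha> \<beta> Lf G x \<longleftrightarrow>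
     x 1 \<in> M \<and>
     (\<forall>l. \<forall>k\<in>{2 ^ l..2 ^ (l + 1) - 1}.
        x (k + 1) = R (x k) (- step_size A \<rho> \<alpha> \<beta> Lf G k *\<^sub>R
          riemannian_gradient M (smoothed_objective f h A \<rho> k) (x k)))"

definition corrected_point ::
  "('b::euclidean_space \<Rightarrow> real) \<Rightarrow> ('a::euclidean_space \<Rightarrow> 'b) \<Rightarrow> real \<Rightarrow> (nat \<Rightarrow> 'a) \<Rightarrow>
   nat \<Rightarrow> 'a" where
  "corrected_point h A \<rho> x k =
     x k - right_pinv A (A (x k) - prox h (smoothing_param \<rho> k) (A (x k)))"

end

theory Submission
  imports Defs
begin

text \<open>
  Replacing \<open>h\<close> by its Moreau envelope makes the objective differentiable, and the gradient of the
  envelope at \<open>A x\<close> is a limiting subgradient \<open>\<zeta>\<close> of \<open>h\<close> at the proximal point \<open>p\<close> of \<open>A x\<close>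
  (\<open>prox_slope_limiting_subdifferential\<close>, \<open>GDERIV_moreau_envelope\<close>). The correction by the pseudoinverse
  is such that \<open>A\<close> maps the corrected point to \<open>p\<close>. Thus the Riemannian gradient of the smoothed
  objective at \<open>x\<close> is already an element of the set whose distance to \<open>0\<close> is to be bounded, except
  that the gradient of \<open>f\<close> is taken at \<open>x\<close> instead of the corrected point. As \<open>p\<close> is within \<open>2 \<mu> Lh\<close> of
  \<open>A x\<close>, both this discrepancy and the distance of \<open>x\<close> to its corrected point are \<open>O(\<mu>)\<close>. With
  \<open>\<mu>\<close> of order \<open>k powr (- 1 / 3)\<close> it suffices that some index between \<open>K\<close> and \<open>2 * K\<close> has a Riemannian
  gradient of size \<open>O(K powr (- 1 / 3))\<close>; then \<open>K\<close> of order \<open>1 / \<epsilon> ^ 3\<close> is enough.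

  Such an index exists by a potential argument. The step size is the inverse of a constant of order
  \<open>k powr (1 / 3)\<close> for which the quadratic upper bound on the smoothed objective survives the
  retraction, so one step decreases this objective by a multiple of
  \<open>k powr (- 1 / 3)\<close> times the squared gradient norm (\<open>retraction_step_decrease\<close>). Passing to the next,
  smaller smoothing parameter increases the objective by at most a multiple of the decrease of the
  parameter (\<open>moreau_envelope_decrease_param\<close>), and these increases telescope. Hence the sum of all
  decrements is finite, and over the \<open>K\<close> indices from \<open>K\<close> on the smallest squared gradient norm is
  \<open>O(K powr (- 2 / 3))\<close> (\<open>potential_decrease_rate\<close>).

  The argument presupposes that the velocities of curves form a linear space
  (\<open>subspace_tangent_space\<close>). Weak convexity makes the envelope differentiable;
  the descent inequality, the bound on the proximal displacement and the subgradient property follow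
  from the minimality of the proximal point and the Lipschitz continuity of \<open>h\<close>.
\<close>

section \<open>Tangent spaces are linear\<close>

lemma Ck_on_cong_open:
  assumes "open S" "\<And>x. x \<in> S \<Longrightarrow> f x = g x" "Ck_on S f k"
  shows "Ck_on S g k"
  using assms(2,3)
proof (induction k arbitrary: f g)
  case 0
  then show ?case by (simp cong: continuous_on_cong)
next
  case (Suc k)
  have *: "(g has_derivative frechet_derivative f (at x)) (at x)" if "x \<in> S" for x
  proof (rule has_derivative_transform_within_open[OF _ assms(1) that])
    show "(f has_derivative frechet_derivative f (at x)) (at x)"
      using that Suc.prems(2) by (simp add: frechet_derivative_works)
  qed (rule Suc.prems(1))
  have "Ck_on S (\<lambda>x. frechet_derivative g (at x) v) k" for v
  proof (rule Suc.IH)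
    show "Ck_on S (\<lambda>x. frechet_derivative f (at x) v) k" using Suc.prems(2) by simp
    show "frechet_derivative f (at x) v = frechet_derivative g (at x) v" if "x \<in> S" for x
      by (rule fun_cong[OF frechet_derivative_at[OF *[OF that]]])
  qed
  with * show ?case by (auto simp: differentiable_def)
qed

lemma Ck_on_scaleR_const:
  assumes "open S" "Ck_on S g k"
  shows "Ck_on S (\<lambda>x. c *\<^sub>R g x) k"
  using assms(2)
proof (induction k arbitrary: g)
  case 0
  then show ?case by (auto intro: continuous_intros)
next
  case (Suc k)
  have *: "((\<lambda>x. c *\<^sub>R g x) has_derivative (\<lambda>v. c *\<^sub>R frechet_derivative g (at x) v)) (at x)"
    if "x \<in> S" for x
    using that Suc.prems by (auto intro!: derivative_eq_intros simp: frechet_derivative_works)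
  have "Ck_on S (\<lambda>x. frechet_derivative (\<lambda>x. c *\<^sub>R g x) (at x) v) k" for v
  proof (rule Ck_on_cong_open[OF assms(1)])
    show "Ck_on S (\<lambda>x. c *\<^sub>R frechet_derivative g (at x) v) k"
      using Suc.prems by (intro Suc.IH) simp
    show "c *\<^sub>R frechet_derivative g (at x) v
        = frechet_derivative (\<lambda>x. c *\<^sub>R g x) (at x) v" if "x \<in> S" for x
      by (rule fun_cong[OF frechet_derivative_at[OF *[OF that]]])
  qed
  with * show ?case by (auto simp: differentiable_def)
qed

text \<open>A chart turns a line in the model subspace into a curve in the manifold. This is the only
  case of the chain rule for higher derivatives that the tangent space requires: the inner map is
  affine, so each differentiation only multiplies by a constant.\<close>

lemma Ck_on_compose_line:
  fixes p w :: "'a::euclidean_space" and S :: "real set"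
  assumes "open S" "\<And>t. t \<in> S \<Longrightarrow> p + t *\<^sub>R w \<in> V" "Ck_on V g k"
  shows "Ck_on S (\<lambda>t. g (p + t *\<^sub>R w)) k"
  using assms(3)
proof (induction k arbitrary: g)
  case 0
  then show ?case
    by simp (rule continuous_on_compose2, assumption, intro continuous_intros, use assms(2) in auto)
next
  case (Suc k)
  have *: "((\<lambda>t. g (p + t *\<^sub>R w)) has_derivative
      (\<lambda>v. v *\<^sub>R frechet_derivative g (at (p + t *\<^sub>R w)) w)) (at t)" if "t \<in> S" for t
  proof -
    have g: "(g has_derivative frechet_derivative g (at (p + t *\<^sub>R w))) (at (p + t *\<^sub>R w))"
      using that Suc.prems assms(2) by (auto simp: frechet_derivative_works)
    have l: "((\<lambda>t. p + t *\<^sub>R w) has_derivative (\<lambda>v. v *\<^sub>R w)) (at t)"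
      by (auto intro!: derivative_eq_intros)
    show ?thesis
      using has_derivative_compose[OF l g]
      unfolding linear_cmul[OF has_derivative_linear[OF g]] .
  qed
  have "Ck_on S (\<lambda>t. frechet_derivative (\<lambda>t. g (p + t *\<^sub>R w)) (at t) v) k" for v
  proof (rule Ck_on_cong_open[OF assms(1)])
    have "Ck_on V (\<lambda>y. frechet_derivative g (at y) w) k" using Suc.prems by simp
    from Ck_on_scaleR_const[OF assms(1) Suc.IH[OF this]]
    show "Ck_on S (\<lambda>t. v *\<^sub>R frechet_derivative g (at (p + t *\<^sub>R w)) w) k" .
    show "v *\<^sub>R frechet_derivative g (at (p + t *\<^sub>R w)) w
        = frechet_derivative (\<lambda>t. g (p + t *\<^sub>R w)) (at t) v" if "t \<in> S" for t
      by (rule fun_cong[OF frechet_derivative_at[OF *[OF that]]])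
  qed
  with * show ?case by (auto simp: differentiable_def)
qed

text \<open>The velocities at \<open>x\<close> are the image of the model subspace \<open>L\<close> under the derivative of the inverse
  slice chart \<open>\<Psi>\<close>: near \<open>x\<close> a curve in \<open>M\<close> is mapped by \<open>\<Phi>\<close> into \<open>L\<close>, which is closed and therefore contains
  the velocity of the image; conversely the lines in \<open>L\<close> are carried by \<open>\<Psi>\<close> to curves in \<open>M\<close>. Only
  because this set is a subspace are the orthogonal projection onto it and the steps
  \<open>- \<gamma> grad F\<close> inside it meaningful.\<close>

lemma subspace_tangent_space:
  assumes "embedded_submanifold M" "x \<in> M"
  shows "subspace (tangent_space M x)"
proof -
  obtain L :: "'a set" and U V \<Phi> \<Psi> where L: "subspace L" and U: "open U" "x \<in> U" and V: "open V"
    and hom: "homeomorphism U V \<Phi> \<Psi>" and sm: "smooth_on U \<Phi>" "smooth_on V \<Psi>"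
    and slice: "\<Phi> ` (M \<inter> U) = L \<inter> V"
    using assms unfolding embedded_submanifold_def by meson
  define p where "p = \<Phi> x"
  define D where "D = frechet_derivative \<Psi> (at p)"
  have p: "p \<in> L" "p \<in> V" "\<Psi> p = x"
    using slice U(2) assms(2) homeomorphism_apply1[OF hom] by (auto simp: p_def)
  have "Ck_on U \<Phi> 1" "Ck_on V \<Psi> 1"
    using sm unfolding smooth_on_def by blast+
  then have dif: "(\<Phi> has_derivative frechet_derivative \<Phi> (at x)) (at x)"
      "(\<Psi> has_derivative D) (at p)"
    using U(2) p(2) by (simp_all add: frechet_derivative_works D_def)
  have "tangent_space M x = D ` L"
  proof
    show "tangent_space M x \<subseteq> D ` L"
    proof
      fix v assume "v \<in> tangent_space M x"
      then obtain \<delta> c where c: "\<delta> > 0" "c ` {-\<delta><..<\<delta>} \<subseteq> M" "c 0 = x"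
          "(c has_vector_derivative v) (at 0)"
        unfolding tangent_space_def by blast
      define w where "w = frechet_derivative \<Phi> (at x) v"
      have w: "((\<lambda>t. \<Phi> (c t)) has_vector_derivative w) (at 0)"
        using has_derivative_compose[OF c(4)[unfolded has_vector_derivative_def]] dif(1)
        unfolding has_vector_derivative_def w_def c(3) linear_cmul[OF has_derivative_linear[OF dif(1)], symmetric]
        by blast
      have "isCont c 0"
        using c(4) has_vector_derivative_continuous by blast
      then have "\<forall>\<^sub>F t in at 0. c t \<in> U"
        using topological_tendstoD[OF _ U(1)] U(2) c(3) by (auto simp: isCont_def)
      moreover have "\<forall>\<^sub>F t in at (0::real). t \<in> {-\<delta><..<\<delta>}"
        using c(1) eventually_at_in_open'[of "{-\<delta><..<\<delta>}" 0] by auto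
      ultimately have "\<forall>\<^sub>F t in at 0. (\<Phi> (c t) - p) /\<^sub>R t \<in> L"
      proof eventually_elim
        case (elim t)
        then have "\<Phi> (c t) \<in> L" using slice c(2) by blast
        then show ?case using L p(1) by (auto intro!: subspace_scale subspace_diff)
      qed
      moreover have "((\<lambda>t. (\<Phi> (c t) - p) /\<^sub>R t) \<longlongrightarrow> w) (at 0)"
      proof -
        have "((\<lambda>t. (\<Phi> (c t) - p - t *\<^sub>R w) /\<^sub>R \<bar>t\<bar>) \<longlongrightarrow> 0) (at 0)"
          using w c(3) by (simp add: has_vector_derivative_def has_derivative_def p_def)
        then have lim: "((\<lambda>t. norm ((\<Phi> (c t) - p - t *\<^sub>R w) /\<^sub>R \<bar>t\<bar>)) \<longlongrightarrow> 0) (at 0)"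
          by (rule tendsto_norm_zero)
        moreover have "norm ((\<Phi> (c t) - p - t *\<^sub>R w) /\<^sub>R \<bar>t\<bar>)
            = norm ((\<Phi> (c t) - p) /\<^sub>R t - w)" if "t \<noteq> 0" for t
        proof -
          have "(\<Phi> (c t) - p) /\<^sub>R t - w = (\<Phi> (c t) - p - t *\<^sub>R w) /\<^sub>R t"
            using that by (simp add: scaleR_diff_right)
          then show ?thesis by simp
        qed
        ultimately have "((\<lambda>t. norm ((\<Phi> (c t) - p) /\<^sub>R t - w)) \<longlongrightarrow> 0) (at 0)"
          by (intro Lim_transform_eventually[OF lim]) (auto simp: eventually_at_filter)
        then show ?thesis by (simp add: tendsto_norm_zero_iff Lim_null[symmetric])
      qed
      ultimately have "w \<in> L"
        by (rule Lim_in_closed_set[OF closed_subspace[OF L] _ at_neq_bot])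
      moreover have "D w = v"
      proof -
        \<comment> \<open>Differentiating \<open>\<Psi> \<circ> \<Phi> = id\<close> at \<open>x\<close> recovers \<open>v\<close> from \<open>w\<close>.\<close>
        have "((\<lambda>y. \<Psi> (\<Phi> y)) has_derivative (\<lambda>v. D (frechet_derivative \<Phi> (at x) v))) (at x)"
          using has_derivative_compose[OF dif(1)] dif(2) by (simp add: p_def)
        then have "((\<lambda>y. y) has_derivative (\<lambda>v. D (frechet_derivative \<Phi> (at x) v))) (at x)"
          by (rule has_derivative_transform_within_open[OF _ U])
             (use homeomorphism_apply1[OF hom] in auto)
        from has_derivative_unique[OF this has_derivative_ident] show ?thesis
          by (simp add: w_def fun_eq_iff)
      qed
      ultimately show "v \<in> D ` L" by blast
    qed
  next
    show "D ` L \<subseteq> tangent_space M x"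
    proof (rule image_subsetI)
      fix w assume w: "w \<in> L"
      have "\<forall>\<^sub>F t in nhds (0::real). p + t *\<^sub>R w \<in> V"
      proof (rule topological_tendstoD[OF _ V])
        have "isCont (\<lambda>t. p + t *\<^sub>R w) (0::real)" by (intro continuous_intros)
        then show "((\<lambda>t. p + t *\<^sub>R w) \<longlongrightarrow> p + 0 *\<^sub>R w) (nhds (0::real))"
          by (metis isCont_def tendsto_at_iff_tendsto_nhds)
      qed (use p in simp)
      then obtain \<delta> where \<delta>: "\<delta> > 0" "\<And>t. \<bar>t\<bar> < \<delta> \<Longrightarrow> p + t *\<^sub>R w \<in> V"
        by (auto simp: eventually_nhds_metric dist_real_def)
      define c where "c t = \<Psi> (p + t *\<^sub>R w)" for t
      have "smooth_on {-\<delta><..<\<delta>} c"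
        unfolding smooth_on_def c_def
        by (intro allI Ck_on_compose_line[where V = V])
           (use sm(2) \<delta> in \<open>auto simp: smooth_on_def\<close>)
      moreover have "c ` {-\<delta><..<\<delta>} \<subseteq> M"
      proof (rule image_subsetI)
        fix t assume "t \<in> {-\<delta><..<\<delta>}"
        then have "p + t *\<^sub>R w \<in> L \<inter> V"
          using \<delta>(2)[of t] p(1) w L by (auto simp: abs_less_iff subspace_add subspace_scale)
        then obtain y where "y \<in> M \<inter> U" "p + t *\<^sub>R w = \<Phi> y" using slice by blast
        then show "c t \<in> M" using homeomorphism_apply1[OF hom] by (simp add: c_def)
      qed
      moreover have "(c has_vector_derivative D w) (at 0)"
      proof -
        have "((\<lambda>t. p + t *\<^sub>R w) has_derivative (\<lambda>v. v *\<^sub>R w)) (at 0)"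
          by (auto intro!: derivative_eq_intros)
        from has_derivative_compose[OF this, of \<Psi> D] show ?thesis
          using dif(2) linear_cmul[OF has_derivative_linear[OF dif(2)]]
          by (simp add: has_vector_derivative_def c_def[abs_def])
      qed
      moreover have "c 0 = x" using p(3) by (simp add: c_def)
      ultimately show "D w \<in> tangent_space M x"
        using \<delta>(1) unfolding tangent_space_def by blast
    qed
  qed
  then show ?thesis
    using linear_subspace_image[OF has_derivative_linear[OF dif(2)] L] by simp
qed

section \<open>Orthogonal projection onto a subspace\<close>

lemma orth_proj_mem_orthogonal:
  assumes "subspace S"
  shows "orth_proj S v \<in> S" "v - orth_proj S v \<in> S\<^sup>\<bottom>"
proof -
  obtain w z where "w \<in> span S" "\<And>u. u \<in> span S \<Longrightarrow> orthogonal z u" "v = w + z"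
    using orthogonal_subspace_decomp_exists[of S v] by metis
  then have "w \<in> S" "v - w \<in> S\<^sup>\<bottom>"
    using assms by (auto simp: span_eq_iff[THEN iffD2] orthogonal_comp_def orthogonal_commute)
  then show "orth_proj S v \<in> S" "v - orth_proj S v \<in> S\<^sup>\<bottom>"
    using orth_proj_unique[OF assms] by auto
qed

lemma inner_orth_proj:
  assumes "subspace S"
  shows "v \<bullet> orth_proj S v = (norm (orth_proj S v))\<^sup>2"
proof -
  have "(v - orth_proj S v) \<bullet> orth_proj S v = 0"
    using orth_proj_mem_orthogonal[OF assms, of v]
    by (auto simp: orthogonal_comp_def orthogonal_def inner_commute)
  then show ?thesis by (simp add: inner_diff_left power2_norm_eq_inner)
qed

lemma norm_orth_proj_le:
  assumes "subspace S"
  shows "norm (orth_proj S v) \<le> norm v"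
proof (cases "orth_proj S v = 0")
  case False
  have "norm (orth_proj S v) * norm (orth_proj S v) \<le> norm v * norm (orth_proj S v)"
    using inner_orth_proj[OF assms, of v] norm_cauchy_schwarz[of v "orth_proj S v"]
    by (simp add: power2_eq_square)
  with False show ?thesis by simp
qed simp

lemma orth_proj_add:
  assumes "subspace S"
  shows "orth_proj S (u + v) = orth_proj S u + orth_proj S v"
proof (rule orth_proj_unique[OF assms])
  note P = orth_proj_mem_orthogonal[OF assms]
  show "orth_proj S u + orth_proj S v \<in> S"
    using P assms by (simp add: subspace_add)
  have "(u - orth_proj S u) + (v - orth_proj S v) \<in> S\<^sup>\<bottom>"
    using P by (intro subspace_add subspace_orthogonal_comp)
  then show "u + v - (orth_proj S u + orth_proj S v) \<in> S\<^sup>\<bottom>"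
    by (simp add: algebra_simps)
qed

section \<open>Proximal points and the Moreau envelope\<close>

lemma lipschitz_real_bound:
  fixes h :: "'b::euclidean_space \<Rightarrow> real"
  assumes "Lh-lipschitz_on UNIV h"
  shows "h y - h z \<le> Lh * norm (z - y)"
  using lipschitz_onD[OF assms, of y z] by (simp add: dist_real_def dist_norm norm_minus_commute)

text \<open>Outside the ball of radius \<open>2 \<mu> Lh\<close> around \<open>y\<close> the quadratic penalty exceeds the largest decrease
  that the Lipschitz function \<open>h\<close> can achieve, so a minimizer over this compact ball is a global one.\<close>

lemma prox_minimizer:
  fixes h :: "'b::euclidean_space \<Rightarrow> real"
  assumes lip: "Lh-lipschitz_on UNIV h" and \<mu>: "\<mu> > 0"
  shows "h (prox h \<mu> y) + 1 / (2 * \<mu>) * (norm (prox h \<mu> y - y))\<^sup>2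
           \<le> h z + 1 / (2 * \<mu>) * (norm (z - y))\<^sup>2"
proof -
  define g where "g = (\<lambda>z. h z + 1 / (2 * \<mu>) * (norm (z - y))\<^sup>2)"
  have Lh: "Lh \<ge> 0" using lip by (rule lipschitz_on_nonneg)
  have "continuous_on (cball y (2 * \<mu> * Lh)) g"
    unfolding g_def
    by (intro continuous_intros continuous_on_subset[OF lipschitz_on_continuous_on[OF lip]]) auto
  moreover have "cball y (2 * \<mu> * Lh) \<noteq> {}" using \<mu> Lh by (simp add: not_less)
  ultimately obtain p
    where p: "p \<in> cball y (2 * \<mu> * Lh)" "\<And>z. z \<in> cball y (2 * \<mu> * Lh) \<Longrightarrow> g p \<le> g z"
    using continuous_attains_inf[OF compact_cball] by metis
  have min: "g p \<le> g z" for z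
  proof (cases "z \<in> cball y (2 * \<mu> * Lh)")
    case False
    define r where "r = norm (z - y)"
    have r: "r > 2 * \<mu> * Lh" "r \<ge> 0" using False by (auto simp: r_def dist_norm norm_minus_commute)
    have "h y - h z \<le> Lh * r" using lipschitz_real_bound[OF lip] by (simp add: r_def)
    also have "\<dots> \<le> r\<^sup>2 / (2 * \<mu>)"
      using mult_right_mono[of "2 * \<mu> * Lh" r r] r \<mu> by (simp add: field_simps power2_eq_square)
    finally have "g y \<le> g z" by (simp add: g_def r_def)
    moreover have "g p \<le> g y" using p(2) \<mu> Lh by simp
    ultimately show ?thesis by simp
  qed (rule p(2))
  have "g (arg_min g (\<lambda>_. True)) \<le> g z"
    by (rule arg_minI[of "\<lambda>_. True" p]) (use min in \<open>auto simp: not_less\<close>)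
  then show ?thesis by (simp add: prox_def g_def)
qed

lemma norm_prox_diff_le:
  fixes h :: "'b::euclidean_space \<Rightarrow> real"
  assumes lip: "Lh-lipschitz_on UNIV h" and \<mu>: "\<mu> > 0"
  shows "norm (prox h \<mu> y - y) \<le> 2 * \<mu> * Lh"
proof (cases "norm (prox h \<mu> y - y) = 0")
  case True
  then show ?thesis using lipschitz_on_nonneg[OF lip] \<mu> by simp
next
  case False
  define r where "r = norm (prox h \<mu> y - y)"
  have r: "r > 0" using False by (simp add: r_def)
  have "1 / (2 * \<mu>) * r\<^sup>2 \<le> Lh * r"
    using prox_minimizer[OF assms, of y y] lipschitz_real_bound[OF lip, of y "prox h \<mu> y"]
    by (simp add: r_def)
  then have "r * r \<le> (2 * \<mu> * Lh) * r" using \<mu> by (simp add: field_simps power2_eq_square)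
  with r show ?thesis by (simp add: r_def)
qed

lemma moreau_envelope_le:
  fixes h :: "'b::euclidean_space \<Rightarrow> real"
  assumes "Lh-lipschitz_on UNIV h" "\<mu> > 0"
  shows "moreau_envelope h \<mu> y \<le> h z + 1 / (2 * \<mu>) * (norm (z - y))\<^sup>2"
  unfolding moreau_envelope_def
  by (rule cINF_lower) (use prox_minimizer[OF assms] in \<open>auto simp: bdd_below_def\<close>)

lemma moreau_envelope_eq_prox:
  fixes h :: "'b::euclidean_space \<Rightarrow> real"
  assumes "Lh-lipschitz_on UNIV h" "\<mu> > 0"
  shows "moreau_envelope h \<mu> y = h (prox h \<mu> y) + 1 / (2 * \<mu>) * (norm (prox h \<mu> y - y))\<^sup>2"
proof (rule antisym[OF moreau_envelope_le[OF assms]])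
  show "h (prox h \<mu> y) + 1 / (2 * \<mu>) * (norm (prox h \<mu> y - y))\<^sup>2 \<le> moreau_envelope h \<mu> y"
    unfolding moreau_envelope_def using prox_minimizer[OF assms] by (intro cINF_greatest) auto
qed

text \<open>This vector has two roles: it is a subgradient of \<open>h\<close> at the proximal point of \<open>y\<close>, and it is the
  gradient of the Moreau envelope at \<open>y\<close>. Their coincidence is what makes a small gradient of the
  smoothed problem certify approximate stationarity for the nonsmooth one.\<close>

definition prox_slope :: "('b::euclidean_space \<Rightarrow> real) \<Rightarrow> real \<Rightarrow> 'b \<Rightarrow> 'b" where
  "prox_slope h \<mu> y = (y - prox h \<mu> y) /\<^sub>R \<mu>"

text \<open>The minimality of \<open>p\<close>, with the square \<open>(norm (z - y))\<^sup>2\<close> expanded around \<open>p\<close>.\<close>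

lemma prox_quadratic_minorant:
  fixes h :: "'b::euclidean_space \<Rightarrow> real" and y z :: 'b
  assumes "Lh-lipschitz_on UNIV h" "\<mu> > 0"
  defines "p \<equiv> prox h \<mu> y" and "\<zeta> \<equiv> prox_slope h \<mu> y"
  shows "h p + \<zeta> \<bullet> (z - p) - 1 / (2 * \<mu>) * (norm (z - p))\<^sup>2 \<le> h z"
proof -
  have "(norm (z - y))\<^sup>2 = (norm (z - p))\<^sup>2 - 2 * \<mu> * (\<zeta> \<bullet> (z - p)) + (norm (p - y))\<^sup>2"
  proof -
    have "\<mu> * (\<zeta> \<bullet> (z - p)) = (y - p) \<bullet> (z - p)"
      using assms(2) by (simp add: \<zeta>_def p_def prox_slope_def)
    then show ?thesis
      by (simp add: power2_norm_eq_inner algebra_simps inner_commute)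
  qed
  then have "1 / (2 * \<mu>) * (norm (z - y))\<^sup>2
      = 1 / (2 * \<mu>) * (norm (z - p))\<^sup>2 - \<zeta> \<bullet> (z - p) + 1 / (2 * \<mu>) * (norm (p - y))\<^sup>2"
    using assms(2) by (simp add: field_simps)
  with prox_minimizer[OF assms(1,2), of y z] show ?thesis
    unfolding p_def by linarith
qed

text \<open>Weak convexity improves the constant \<open>1 / (2 * \<mu>)\<close> of the preceding minorant to \<open>\<rho> / 2\<close>: the
  quadratic error of that minorant at the point \<open>p + t (z - p)\<close> is of order \<open>t\<^sup>2\<close>, hence vanishes after
  division by \<open>t\<close> in the limit \<open>t \<rightarrow> 0\<close>, and only the defect of convexity remains.\<close>

lemma prox_weakly_convex_minorant:
  fixes h :: "'b::euclidean_space \<Rightarrow> real" and y z :: 'b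
  assumes lip: "Lh-lipschitz_on UNIV h" and \<mu>: "\<mu> > 0" and wc: "weakly_convex \<rho> h"
  defines "p \<equiv> prox h \<mu> y" and "\<zeta> \<equiv> prox_slope h \<mu> y"
  shows "h p + \<zeta> \<bullet> (z - p) - \<rho> / 2 * (norm (z - p))\<^sup>2 \<le> h z"
proof -
  define d where "d = z - p"
  define N where "N = (norm d)\<^sup>2"
  have bound: "\<zeta> \<bullet> d - t * (N / (2 * \<mu>)) - \<rho> / 2 * (1 - t) * N \<le> h z - h p"
    if t: "0 < t" "t < 1" for t
  proof -
    have q: "(1 - t) *\<^sub>R p + t *\<^sub>R z = p + t *\<^sub>R d" by (simp add: d_def algebra_simps)
    have "h (p + t *\<^sub>R d) + \<rho> / 2 * (norm (p + t *\<^sub>R d))\<^sup>2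
        \<le> (1 - t) * (h p + \<rho> / 2 * (norm p)\<^sup>2) + t * (h z + \<rho> / 2 * (norm z)\<^sup>2)"
      using convex_onD[OF wc[unfolded weakly_convex_def], of t p z] t q by simp
    moreover
    have "(norm (p + t *\<^sub>R d))\<^sup>2 = (1 - t) * (norm p)\<^sup>2 + t * (norm z)\<^sup>2 - t * (1 - t) * N"
      unfolding N_def d_def power2_norm_eq_inner
      by (simp add: inner_diff_left inner_diff_right inner_add_left inner_add_right inner_commute)
         (simp add: algebra_simps)
    then have "\<rho> / 2 * (norm (p + t *\<^sub>R d))\<^sup>2
        = (1 - t) * (\<rho> / 2 * (norm p)\<^sup>2) + t * (\<rho> / 2 * (norm z)\<^sup>2) - \<rho> / 2 * (t * (1 - t) * N)"
      by (simp only: distrib_left right_diff_distrib mult.left_commute)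
    ultimately have u: "h (p + t *\<^sub>R d) \<le> (1 - t) * h p + t * h z + \<rho> / 2 * (t * (1 - t) * N)"
      unfolding distrib_left by linarith
    have l: "h p + t * (\<zeta> \<bullet> d) - 1 / (2 * \<mu>) * (t\<^sup>2 * N) \<le> h (p + t *\<^sub>R d)"
      using prox_quadratic_minorant[OF lip \<mu>, where z = "p + t *\<^sub>R d" and y = y]
      by (simp add: p_def \<zeta>_def N_def power_mult_distrib)
    have "t * (\<zeta> \<bullet> d - t * (N / (2 * \<mu>)) - \<rho> / 2 * (1 - t) * N) \<le> t * (h z - h p)"
      using order_trans[OF l u] by (simp add: algebra_simps power2_eq_square diff_divide_distrib)
    then show ?thesis using t by simp
  qed
  have "\<zeta> \<bullet> d - 0 * (N / (2 * \<mu>)) - \<rho> / 2 * (1 - 0) * N \<le> h z - h p"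
  proof (rule tendsto_upperbound)
    show "((\<lambda>t. \<zeta> \<bullet> d - t * (N / (2 * \<mu>)) - \<rho> / 2 * (1 - t) * N) \<longlongrightarrow>
        \<zeta> \<bullet> d - 0 * (N / (2 * \<mu>)) - \<rho> / 2 * (1 - 0) * N) (at_right (0::real))"
      by (intro tendsto_intros)
    show "\<forall>\<^sub>F t in at_right 0. \<zeta> \<bullet> d - t * (N / (2 * \<mu>)) - \<rho> / 2 * (1 - t) * N \<le> h z - h p"
      using eventually_at_right_real[OF zero_less_one] by eventually_elim (use bound in auto)
  qed simp
  then show ?thesis by (simp add: d_def N_def algebra_simps)
qed

text \<open>The quadratic minorant at \<open>p\<close> makes the slope a Frechet subgradient there; constant sequences
  then show that it is a limiting one.\<close>

lemma prox_slope_limiting_subdifferential: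
  fixes h :: "'b::euclidean_space \<Rightarrow> real"
  assumes lip: "Lh-lipschitz_on UNIV h" and \<mu>: "\<mu> > 0"
  shows "prox_slope h \<mu> y \<in> limiting_subdifferential h (prox h \<mu> y)"
proof -
  define p where "p = prox h \<mu> y"
  define \<zeta> where "\<zeta> = prox_slope h \<mu> y"
  have lb: "- (1 / (2 * \<mu>) * norm (z - p)) \<le> (h z - h p - \<zeta> \<bullet> (z - p)) / norm (z - p)"
    if "z \<noteq> p" for z
    using prox_quadratic_minorant[OF lip \<mu>, of y z] that
    by (simp add: p_def \<zeta>_def field_simps power2_eq_square)
  have "((\<lambda>z. ereal (- (1 / (2 * \<mu>) * norm (z - p)))) \<longlongrightarrow> ereal (- (1 / (2 * \<mu>) * norm (p - p)))) (at p)"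
    by (intro tendsto_intros)
  then have "Liminf (at p) (\<lambda>z. ereal (- (1 / (2 * \<mu>) * norm (z - p)))) = 0"
    by (subst lim_imp_Liminf) (auto simp: zero_ereal_def)
  moreover have "Liminf (at p) (\<lambda>z. ereal (- (1 / (2 * \<mu>) * norm (z - p))))
      \<le> Liminf (at p) (\<lambda>z. ereal ((h z - h p - \<zeta> \<bullet> (z - p)) / norm (z - p)))"
    by (rule Liminf_mono) (use lb in \<open>auto simp: eventually_at_filter\<close>)
  ultimately have "\<zeta> \<in> frechet_subdifferential h p" by (simp add: frechet_subdifferential_def)
  then have "(\<lambda>_. p) \<longlonglongrightarrow> p \<and> (\<lambda>_::nat. h p) \<longlonglongrightarrow> h p \<and>
      (\<forall>_::nat. \<zeta> \<in> frechet_subdifferential h p) \<and> (\<lambda>_. \<zeta>) \<longlonglongrightarrow> \<zeta>"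
    by simp
  then show ?thesis
    unfolding limiting_subdifferential_def p_def[symmetric] \<zeta>_def[symmetric]
    by (intro CollectI exI[of _ "\<lambda>_. p"] exI[of _ "\<lambda>_. \<zeta>"])
qed

text \<open>Inserting the proximal point of \<open>y\<close> as a competitor at \<open>y'\<close> gives this descent inequality, with
  the curvature of the penalty.\<close>

lemma moreau_envelope_upper_bound:
  fixes h :: "'b::euclidean_space \<Rightarrow> real"
  assumes lip: "Lh-lipschitz_on UNIV h" and \<mu>: "\<mu> > 0"
  shows "moreau_envelope h \<mu> y'
    \<le> moreau_envelope h \<mu> y + prox_slope h \<mu> y \<bullet> (y' - y) + 1 / (2 * \<mu>) * (norm (y' - y))\<^sup>2"
proof -
  define p where "p = prox h \<mu> y"
  have "(norm (p - y'))\<^sup>2 = (norm (p - y))\<^sup>2 + 2 * \<mu> * (prox_slope h \<mu> y \<bullet> (y' - y)) + (norm (y' - y))\<^sup>2"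
  proof -
    have "\<mu> * (prox_slope h \<mu> y \<bullet> (y' - y)) = (y - p) \<bullet> (y' - y)"
      using \<mu> by (simp add: p_def prox_slope_def)
    then show ?thesis
      by (simp add: power2_norm_eq_inner algebra_simps inner_commute)
  qed
  with moreau_envelope_le[OF assms, of y' p] moreau_envelope_eq_prox[OF assms, of y] \<mu>
  show ?thesis by (simp add: p_def field_simps)
qed

text \<open>The weakly convex minorant at the proximal point of \<open>y\<close> is evaluated at the proximal point of
  \<open>y'\<close>. With \<open>w\<close> the displacement of the proximal points and \<open>d = y' - y\<close>, the remaining error is
  \<open>(norm (w - d))\<^sup>2 / (2 * \<mu>) - \<rho> / 2 * (norm w)\<^sup>2\<close>, which is at least \<open>- \<rho> * (norm d)\<^sup>2\<close> because
  \<open>\<rho> \<le> 1 / (2 * \<mu>)\<close>.\<close>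

lemma moreau_envelope_lower_bound:
  fixes h :: "'b::euclidean_space \<Rightarrow> real"
  assumes lip: "Lh-lipschitz_on UNIV h" and \<mu>: "\<mu> > 0" and wc: "weakly_convex \<rho> h"
    and \<rho>: "\<rho> > 0" "\<mu> \<le> 1 / (2 * \<rho>)"
  shows "moreau_envelope h \<mu> y + prox_slope h \<mu> y \<bullet> (y' - y) - \<rho> * (norm (y' - y))\<^sup>2
    \<le> moreau_envelope h \<mu> y'"
proof -
  define p where "p = prox h \<mu> y"
  define q where "q = prox h \<mu> y'"
  define \<zeta> where "\<zeta> = prox_slope h \<mu> y"
  define w where "w = q - p"
  define d where "d = y' - y"
  have z: "y - p = \<mu> *\<^sub>R \<zeta>" using \<mu> by (simp add: \<zeta>_def p_def prox_slope_def)
  have e: "q - y' = (w - d) - \<mu> *\<^sub>R \<zeta>" by (simp add: w_def d_def z[symmetric])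
  have "(norm (q - y'))\<^sup>2 = (norm (w - d))\<^sup>2 - 2 * \<mu> * (\<zeta> \<bullet> (w - d)) + \<mu>\<^sup>2 * (norm \<zeta>)\<^sup>2"
    unfolding e power2_norm_eq_inner
    by (simp add: inner_diff_left inner_diff_right inner_commute algebra_simps power2_eq_square)
  then have n: "1 / (2 * \<mu>) * (norm (q - y'))\<^sup>2
      = 1 / (2 * \<mu>) * (norm (w - d))\<^sup>2 - \<zeta> \<bullet> (w - d) + \<mu> / 2 * (norm \<zeta>)\<^sup>2"
    using \<mu> by (simp add: field_simps power2_eq_square)
  have m: "1 / (2 * \<mu>) * (norm (p - y))\<^sup>2 = \<mu> / 2 * (norm \<zeta>)\<^sup>2"
    using \<mu> by (simp add: norm_minus_commute[of p] z power_mult_distrib field_simps power2_eq_square)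
  have h: "h p + \<zeta> \<bullet> w - \<rho> / 2 * (norm w)\<^sup>2 \<le> h q"
    using prox_weakly_convex_minorant[OF lip \<mu> wc, of y q] by (simp add: p_def \<zeta>_def w_def)
  have "(norm w)\<^sup>2 \<le> 2 * (norm (w - d))\<^sup>2 + 2 * (norm d)\<^sup>2"
  proof -
    have "0 \<le> (norm ((w - d) - d))\<^sup>2" by simp
    then show ?thesis
      unfolding power2_norm_eq_inner
      by (simp add: inner_diff_left inner_diff_right inner_commute algebra_simps)
  qed
  then have "\<rho> / 2 * (norm w)\<^sup>2 \<le> \<rho> / 2 * (2 * (norm (w - d))\<^sup>2 + 2 * (norm d)\<^sup>2)"
    using \<rho> by (intro mult_left_mono) auto
  moreover have "\<rho> * (norm (w - d))\<^sup>2 \<le> 1 / (2 * \<mu>) * (norm (w - d))\<^sup>2"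
    using \<rho> \<mu> by (intro mult_right_mono) (auto simp: field_simps)
  ultimately have "\<rho> / 2 * (norm w)\<^sup>2 \<le> 1 / (2 * \<mu>) * (norm (w - d))\<^sup>2 + \<rho> * (norm d)\<^sup>2"
    by (simp add: algebra_simps)
  with h n m show ?thesis
    unfolding moreau_envelope_eq_prox[OF lip \<mu>] p_def[symmetric] q_def[symmetric]
      \<zeta>_def[symmetric] d_def[symmetric]
    by (simp add: inner_diff_right)
qed

lemma GDERIV_if_quadratic_bounds:
  fixes F :: "'b::euclidean_space \<Rightarrow> real"
  assumes "\<And>y'. \<bar>F y' - F y - D \<bullet> (y' - y)\<bar> \<le> C * (norm (y' - y))\<^sup>2"
  shows "GDERIV F y :> D"
  unfolding gderiv_def
proof (rule has_derivativeI)
  show "bounded_linear (\<lambda>v. v \<bullet> D)" by (rule bounded_linear_inner_left)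
  have "((\<lambda>y'. C * norm (y' - y)) \<longlongrightarrow> C * norm (y - y)) (at y)" by (intro tendsto_intros)
  then have "((\<lambda>y'. C * norm (y' - y)) \<longlongrightarrow> 0) (at y)" by simp
  then show "((\<lambda>y'. (F y' - F y - (y' - y) \<bullet> D) /\<^sub>R norm (y' - y)) \<longlongrightarrow> 0) (at y)"
  proof (rule Lim_null_comparison[rotated])
    show "\<forall>\<^sub>F y' in at y. norm ((F y' - F y - (y' - y) \<bullet> D) /\<^sub>R norm (y' - y)) \<le> C * norm (y' - y)"
      unfolding eventually_at_filter
    proof (intro always_eventually allI impI)
      fix y' assume "y' \<noteq> y"
      then show "norm ((F y' - F y - (y' - y) \<bullet> D) /\<^sub>R norm (y' - y)) \<le> C * norm (y' - y)"
        using assms[of y'] by (simp add: abs_mult inner_commute field_simps power2_eq_square)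
    qed
  qed
qed

lemma GDERIV_moreau_envelope:
  fixes h :: "'b::euclidean_space \<Rightarrow> real"
  assumes lip: "Lh-lipschitz_on UNIV h" and \<mu>: "\<mu> > 0" and wc: "weakly_convex \<rho> h"
    and \<rho>: "\<rho> > 0" "\<mu> \<le> 1 / (2 * \<rho>)"
  shows "GDERIV (moreau_envelope h \<mu>) y :> prox_slope h \<mu> y"
proof (rule GDERIV_if_quadratic_bounds)
  fix y'
  have "\<rho> \<le> 1 / (2 * \<mu>)" using \<rho> \<mu> by (simp add: field_simps)
  then have "\<rho> * (norm (y' - y))\<^sup>2 \<le> 1 / (2 * \<mu>) * (norm (y' - y))\<^sup>2"
    by (rule mult_right_mono) simp
  with moreau_envelope_upper_bound[OF lip \<mu>, of y' y] moreau_envelope_lower_bound[OF assms, of y y']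
  show "\<bar>moreau_envelope h \<mu> y' - moreau_envelope h \<mu> y - prox_slope h \<mu> y \<bullet> (y' - y)\<bar>
      \<le> 1 / (2 * \<mu>) * (norm (y' - y))\<^sup>2" by linarith
qed

text \<open>The envelope is at least the value of \<open>h\<close> at the proximal point, which is within \<open>2 \<mu> Lh\<close>
  of \<open>y\<close>.\<close>

lemma moreau_envelope_ge:
  fixes h :: "'b::euclidean_space \<Rightarrow> real"
  assumes lip: "Lh-lipschitz_on UNIV h" and \<mu>: "\<mu> > 0"
  shows "h y - 2 * \<mu> * Lh\<^sup>2 \<le> moreau_envelope h \<mu> y"
proof -
  have "h y - h (prox h \<mu> y) \<le> Lh * (2 * \<mu> * Lh)"
    using lipschitz_real_bound[OF lip, of y "prox h \<mu> y"] norm_prox_diff_le[OF assms, of y]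
      lipschitz_on_nonneg[OF lip] by (meson mult_left_mono order_trans)
  then have "h y - 2 * \<mu> * Lh\<^sup>2 \<le> h (prox h \<mu> y)" by (simp add: power2_eq_square algebra_simps)
  also have "\<dots> \<le> moreau_envelope h \<mu> y"
    using \<mu> by (simp add: moreau_envelope_eq_prox[OF assms])
  finally show ?thesis .
qed

text \<open>The proximal point for \<open>\<mu>\<close> is a competitor for \<open>\<mu>'\<close>. The bound is linear in \<open>\<mu> - \<mu>'\<close> and therefore
  telescopes along a decreasing sequence of smoothing parameters; the ratio condition holds for
  consecutive parameters of the method.\<close>

lemma moreau_envelope_decrease_param:
  fixes h :: "'b::euclidean_space \<Rightarrow> real"
  assumes lip: "Lh-lipschitz_on UNIV h" and \<mu>: "\<mu>' > 0" "\<mu>' \<le> \<mu>" "\<mu> \<le> 2 * \<mu>'"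
  shows "moreau_envelope h \<mu>' y \<le> moreau_envelope h \<mu> y + 4 * Lh\<^sup>2 * (\<mu> - \<mu>')"
proof -
  have \<mu>0: "\<mu> > 0" using \<mu> by simp
  define r where "r = norm (prox h \<mu> y - y)"
  have "r\<^sup>2 \<le> (2 * \<mu> * Lh)\<^sup>2"
    unfolding r_def by (rule power_mono[OF norm_prox_diff_le[OF lip \<mu>0]]) simp
  then have "(1 / (2 * \<mu>') - 1 / (2 * \<mu>)) * r\<^sup>2 \<le> (1 / (2 * \<mu>') - 1 / (2 * \<mu>)) * (2 * \<mu> * Lh)\<^sup>2"
    using \<mu> \<mu>0 by (intro mult_left_mono) (auto simp: field_simps)
  also have "\<dots> = 2 * Lh\<^sup>2 * (\<mu> - \<mu>') * (\<mu> / \<mu>')"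
    using \<mu> \<mu>0 by (simp add: field_simps power2_eq_square)
  also have "\<dots> \<le> 2 * Lh\<^sup>2 * (\<mu> - \<mu>') * 2"
    using \<mu> by (intro mult_left_mono mult_nonneg_nonneg) (auto simp: field_simps)
  finally have "1 / (2 * \<mu>') * r\<^sup>2 - 1 / (2 * \<mu>) * r\<^sup>2 \<le> 4 * Lh\<^sup>2 * (\<mu> - \<mu>')"
    by (simp add: algebra_simps)
  with moreau_envelope_le[OF lip \<mu>(1), of y "prox h \<mu> y"] moreau_envelope_eq_prox[OF lip \<mu>0, of y]
  show ?thesis by (simp add: r_def)
qed

section \<open>Descent of the smoothed objective\<close>

text \<open>Along the segment from \<open>y\<close> to \<open>y'\<close>, the difference \<open>\<phi>\<close> of \<open>f\<close> and the quadratic model has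
  nonpositive derivative.\<close>

lemma lipschitz_gradient_upper_bound:
  fixes f :: "'a::euclidean_space \<Rightarrow> real"
  assumes D: "\<And>y. GDERIV f y :> g y" and lip: "L-lipschitz_on UNIV g"
  shows "f y' \<le> f y + g y \<bullet> (y' - y) + L / 2 * (norm (y' - y))\<^sup>2"
proof -
  define d where "d = y' - y"
  define \<phi> where "\<phi> t = f (y + t *\<^sub>R d) - t * (g y \<bullet> d) - L / 2 * t\<^sup>2 * (norm d)\<^sup>2" for t
  have "\<phi> 1 \<le> \<phi> 0"
  proof (rule DERIV_nonpos_imp_nonincreasing[of 0 1 \<phi>])
    fix t :: real assume t: "0 \<le> t" "t \<le> 1"
    have "((\<lambda>t. y + t *\<^sub>R d) has_derivative (\<lambda>v. v *\<^sub>R d)) (at t)"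
      by (auto intro!: derivative_eq_intros)
    from has_derivative_compose[OF this D[unfolded gderiv_def]]
    have "DERIV (\<lambda>t. f (y + t *\<^sub>R d)) t :> d \<bullet> g (y + t *\<^sub>R d)"
      by (simp add: has_field_derivative_def mult_commute_abs)
    then have "DERIV \<phi> t :> g (y + t *\<^sub>R d) \<bullet> d - g y \<bullet> d - L * t * (norm d)\<^sup>2"
      unfolding \<phi>_def by (auto intro!: derivative_eq_intros simp: inner_commute)
    moreover have "(g (y + t *\<^sub>R d) - g y) \<bullet> d \<le> L * t * (norm d)\<^sup>2"
    proof -
      have "(g (y + t *\<^sub>R d) - g y) \<bullet> d \<le> norm (g (y + t *\<^sub>R d) - g y) * norm d"
        by (rule norm_cauchy_schwarz)
      also have "\<dots> \<le> (L * (t * norm d)) * norm d"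
        using lipschitz_onD[OF lip, of "y + t *\<^sub>R d" y] t
        by (intro mult_right_mono) (auto simp: dist_norm)
      finally show ?thesis by (simp add: power2_eq_square mult.assoc)
    qed
    ultimately show "\<exists>D. DERIV \<phi> t :> D \<and> D \<le> 0"
      by (auto simp: inner_diff_left)
  qed simp
  then show ?thesis by (simp add: \<phi>_def d_def)
qed

lemma GDERIV_gradient:
  assumes "f differentiable (at y)"
  shows "GDERIV f y :> gradient f y"
proof -
  obtain f' where f': "(f has_derivative f') (at y)" using assms by (auto simp: differentiable_def)
  then have "linear f'" by (rule has_derivative_linear)
  then have "f' = (\<lambda>v. v \<bullet> adjoint f' 1)" by (simp add: adjoint_works)
  then have "GDERIV f y :> adjoint f' 1" using f' by (metis gderiv_def)
  then show ?thesis using gradient_eqI by metis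
qed

lemma GDERIV_compose_linear:
  fixes A :: "'a::euclidean_space \<Rightarrow> 'b::euclidean_space"
  assumes "linear A" "GDERIV F (A y) :> D"
  shows "GDERIV (\<lambda>y. F (A y)) y :> adjoint A D"
  using has_derivative_compose[OF linear_imp_has_derivative[OF assms(1)] assms(2)[unfolded gderiv_def]]
  by (simp add: gderiv_def adjoint_works[OF assms(1)])

text \<open>Surjectivity of \<open>A\<close> makes \<open>A A\<^sup>*\<close> injective: if \<open>A A\<^sup>* y = 0\<close> then \<open>A\<^sup>* y = 0\<close>, so \<open>y\<close> is orthogonal
  to the range of \<open>A\<close>. In finite dimension \<open>A A\<^sup>*\<close> is then bijective.\<close>

lemma right_pinv_right_inverse:
  fixes A :: "'a::euclidean_space \<Rightarrow> 'b::euclidean_space"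
  assumes "linear A" "surj A"
  shows "A (right_pinv A y) = y" and "linear (right_pinv A)"
proof -
  have lin: "linear (A \<circ> adjoint A)"
    using assms(1) adjoint_linear linear_compose by blast
  have "inj (A \<circ> adjoint A)"
    unfolding linear_injective_0[OF lin]
  proof (intro allI impI)
    fix y assume "(A \<circ> adjoint A) y = 0"
    then have "A (adjoint A y) \<bullet> y = 0" by simp
    then have *: "adjoint A y = 0" by (simp add: adjoint_works[OF assms(1), symmetric])
    obtain u where "y = A u" using assms(2) by blast
    then have "y \<bullet> y = u \<bullet> adjoint A y" by (simp add: adjoint_works[OF assms(1)])
    then show "y = 0" by (simp add: *)
  qed
  then have "surj (A \<circ> adjoint A)" using lin linear_injective_imp_surjective by blast
  then have "(A \<circ> adjoint A) (inv (A \<circ> adjoint A) y) = y" by (rule surj_f_inv_f)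
  then show "A (right_pinv A y) = y" by (simp add: right_pinv_def)
  show "linear (right_pinv A)"
    unfolding right_pinv_def
    by (intro linear_compose adjoint_linear assms(1) inj_linear_imp_inv_linear lin \<open>inj _\<close>)
qed

lemma smoothed_objective_upper_bound:
  fixes f :: "'a::euclidean_space \<Rightarrow> real" and h :: "'b::euclidean_space \<Rightarrow> real"
  assumes f: "\<And>y. GDERIV f y :> g y" "Lf-lipschitz_on UNIV g"
    and lip: "Lh-lipschitz_on UNIV h" and \<mu>: "\<mu> > 0" and A: "linear A"
  shows "f y' + moreau_envelope h \<mu> (A y') \<le> f y + moreau_envelope h \<mu> (A y)
    + (g y + adjoint A (prox_slope h \<mu> (A y))) \<bullet> (y' - y)
    + (Lf + (onorm A)\<^sup>2 * inverse \<mu>) / 2 * (norm (y' - y))\<^sup>2"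
proof -
  have "norm (A y' - A y) \<le> onorm A * norm (y' - y)"
    using onorm[OF linear_conv_bounded_linear[THEN iffD1, OF A], of "y' - y"]
    by (simp add: linear_diff[OF A])
  then have "(norm (A y' - A y))\<^sup>2 \<le> (onorm A)\<^sup>2 * (norm (y' - y))\<^sup>2"
    unfolding power_mult_distrib[symmetric] by (rule power_mono) simp
  then have "1 / (2 * \<mu>) * (norm (A y' - A y))\<^sup>2 \<le> 1 / (2 * \<mu>) * ((onorm A)\<^sup>2 * (norm (y' - y))\<^sup>2)"
    using \<mu> by (intro mult_left_mono) auto
  moreover have "prox_slope h \<mu> (A y) \<bullet> (A y' - A y) = adjoint A (prox_slope h \<mu> (A y)) \<bullet> (y' - y)"
    by (simp add: adjoint_clauses[OF A] linear_diff[OF A])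
  moreover note lipschitz_gradient_upper_bound[OF f, of y' y]
    moreau_envelope_upper_bound[OF lip \<mu>, of "A y'" "A y"]
  moreover have "(Lf + (onorm A)\<^sup>2 * inverse \<mu>) / 2 * (norm (y' - y))\<^sup>2
      = Lf / 2 * (norm (y' - y))\<^sup>2 + 1 / (2 * \<mu>) * ((onorm A)\<^sup>2 * (norm (y' - y))\<^sup>2)"
    using \<mu> by (simp add: field_simps)
  ultimately show ?thesis unfolding inner_add_left by linarith
qed

text \<open>The step \<open>u\<close> minimizes the quadratic model with curvature \<open>\<kappa>\<close> over \<open>T\<close>. The two terms of \<open>\<kappa>\<close>
  account for the two ways in which \<open>y' - y\<close> differs from \<open>u\<close>: its length may be larger by the factor
  \<open>\<alpha>\<close>, and its second-order deviation from \<open>u\<close> is weighted by the full, not only the tangential,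
  gradient \<open>D\<close>.\<close>

lemma retraction_step_decrease:
  fixes F :: "'a::euclidean_space \<Rightarrow> real"
  assumes T: "subspace T"
    and F: "F y' \<le> F y + D \<bullet> (y' - y) + L / 2 * (norm (y' - y))\<^sup>2" and L: "L \<ge> 0"
    and D: "norm D \<le> G"
    and \<kappa>: "\<kappa> = \<alpha>\<^sup>2 * L + 2 * G * \<beta>" "\<kappa> > 0"
    and u: "u = - (1 / \<kappa>) *\<^sub>R orth_proj T D"
    and R: "norm (y' - y) \<le> \<alpha> * norm u" "norm (y' - y - u) \<le> \<beta> * (norm u)\<^sup>2"
  shows "F y' \<le> F y - 1 / (2 * \<kappa>) * (norm (orth_proj T D))\<^sup>2"
proof -
  have "D \<bullet> (y' - y - u) \<le> norm D * norm (y' - y - u)" by (rule norm_cauchy_schwarz)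
  also have "\<dots> \<le> G * (\<beta> * (norm u)\<^sup>2)"
    using D R(2) norm_ge_zero[of D] by (intro mult_mono norm_ge_zero) linarith+
  finally have lin: "D \<bullet> (y' - y) \<le> D \<bullet> u + G * \<beta> * (norm u)\<^sup>2"
    by (simp add: inner_diff_right)
  have "L / 2 * (norm (y' - y))\<^sup>2 \<le> L / 2 * (\<alpha> * norm u)\<^sup>2"
    using L R(1) by (intro mult_left_mono power_mono) auto
  with lin F have "F y' \<le> F y + D \<bullet> u + \<kappa> / 2 * (norm u)\<^sup>2"
    by (simp add: \<kappa>(1) power_mult_distrib algebra_simps add_divide_distrib)
  also have "D \<bullet> u = - (1 / \<kappa>) * (norm (orth_proj T D))\<^sup>2"
    by (simp add: u inner_orth_proj[OF T])
  also have "\<kappa> / 2 * (norm u)\<^sup>2 = 1 / (2 * \<kappa>) * (norm (orth_proj T D))\<^sup>2"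
    using \<kappa>(2) by (simp add: u power_divide power2_eq_square)
  finally show ?thesis by simp
qed

section \<open>From a decreasing potential to the complexity bound\<close>

text \<open>The decrements over \<open>{K..<2 * K}\<close> sum to at most \<open>P 1 - m\<close>. If every \<open>a k\<close> there exceeded
  \<open>C * K powr (- 1 / 3)\<close>, each of the \<open>K\<close> decrements would exceed
  \<open>c * (2 * K) powr (- 1 / 3) * C\<^sup>2 * K powr (- 2 / 3) \<ge> c * C\<^sup>2 / (2 * K)\<close>, which exhausts \<open>P 1 - m\<close>
  for the constant \<open>C\<close> of the proof.\<close>

lemma potential_decrease_rate:
  fixes a P :: "nat \<Rightarrow> real"
  assumes c: "c > 0" and a: "\<And>k. a k \<ge> 0"
    and dec: "\<And>k. k \<ge> 1 \<Longrightarrow> c * real k powr (- 1 / 3) * (a k)\<^sup>2 \<le> P k - P (Suc k)"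
    and m: "\<And>k. k \<ge> 1 \<Longrightarrow> m \<le> P k"
  obtains C where "C \<ge> 0"
    "\<And>K. K \<ge> 1 \<Longrightarrow> \<exists>k\<in>{K..<2 * K}. a k \<le> C * real K powr (- 1 / 3)"
proof
  define C where "C = sqrt (2 * (P 1 - m) / c)"
  show "C \<ge> 0" using c m[of 1] by (simp add: C_def)
  have C2: "C\<^sup>2 = 2 * (P 1 - m) / c" using c m[of 1] by (simp add: C_def)
  fix K :: nat assume K: "K \<ge> 1"
  show "\<exists>k\<in>{K..<2 * K}. a k \<le> C * real K powr (- 1 / 3)"
  proof (rule ccontr)
    assume "\<not> ?thesis"
    then have big: "C * real K powr (- 1 / 3) < a k" if "k \<in> {K..<2 * K}" for k
      using that by (meson not_le)
    have increment: "(P 1 - m) / K < P k - P (Suc k)" if k: "k \<in> {K..<2 * K}" for k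
    proof -
      have "(C * real K powr (- 1 / 3))\<^sup>2 < (a k)\<^sup>2"
        using big[OF k] \<open>C \<ge> 0\<close> by (intro power_strict_mono) auto
      then have sq: "C\<^sup>2 * real K powr (- 2 / 3) < (a k)\<^sup>2"
        by (simp add: power_mult_distrib power2_eq_square[of "_ powr _"] flip: powr_add)
      have "1 / 2 * real K powr (- 1 / 3) \<le> 2 powr (- 1 / 3) * real K powr (- 1 / 3)"
        using powr_mono[of "-1" "- 1 / 3" "2::real"]
        by (intro mult_right_mono) (auto simp: powr_minus)
      also have "\<dots> = (2 * real K) powr (- 1 / 3)" by (simp add: powr_mult)
      also have "\<dots> \<le> real k powr (- 1 / 3)"
        using k K by (intro powr_mono2') auto
      finally have pw: "1 / 2 * real K powr (- 1 / 3) \<le> real k powr (- 1 / 3)" .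
      have "real K powr (- 1 / 3) * real K powr (- 2 / 3) = 1 / real K"
        using K by (simp add: powr_minus_divide flip: powr_add)
      moreover have "c * C\<^sup>2 / 2 = P 1 - m" using c by (simp add: C2)
      ultimately have "(P 1 - m) / K
          = c * C\<^sup>2 / 2 * (real K powr (- 1 / 3) * real K powr (- 2 / 3))"
        by (metis mult.right_neutral times_divide_eq_right)
      also have "\<dots> = c * (1 / 2 * real K powr (- 1 / 3)) * (C\<^sup>2 * real K powr (- 2 / 3))"
        by simp
      also have "\<dots> < c * (1 / 2 * real K powr (- 1 / 3)) * (a k)\<^sup>2"
        using c K sq by (intro mult_strict_left_mono) auto
      also have "\<dots> \<le> c * real k powr (- 1 / 3) * (a k)\<^sup>2"
        using c pw by (intro mult_right_mono mult_left_mono) auto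
      also have "\<dots> \<le> P k - P (Suc k)" using k K by (intro dec) auto
      finally show ?thesis .
    qed
    have "P 1 - m = (\<Sum>k=K..<2 * K. (P 1 - m) / K)" using K by simp
    also have "\<dots> < (\<Sum>k=K..<2 * K. P k - P (Suc k))"
      using K by (intro sum_strict_mono increment) auto
    also have "\<dots> = P K - P (2 * K)"
      using sum_Suc_diff'[of K "2 * K" P] by (simp add: sum_subtractf)
    also have "P K \<le> P 1"
      using K
    proof (induction K rule: dec_induct)
      case (step k)
      have "0 \<le> c * real k powr (- 1 / 3) * (a k)\<^sup>2" using c by simp
      with dec[of k] step show ?case by simp
    qed simp
    finally show False using m[of "2 * K"] K by simp
  qed
qed

text \<open>The number \<open>K\<close> is chosen of size \<open>(C / \<epsilon>) ^ 3\<close>; the index found in the block is less than \<open>2 * K\<close>.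
  The summand \<open>1\<close> in \<open>N\<close> keeps \<open>K\<close> positive when \<open>C = 0\<close>.\<close>

lemma cube_root_rate_imp_complexity:
  fixes Q :: "nat \<Rightarrow> real"
  assumes C: "C \<ge> 0"
    and rate: "\<And>K. K \<ge> 1 \<Longrightarrow> \<exists>k\<in>{K..<2 * K}. Q k \<le> C * real K powr (- 1 / 3)"
  shows "\<exists>k' :: real \<Rightarrow> nat. (\<forall>\<epsilon>>0. k' \<epsilon> \<ge> 1 \<and> Q (k' \<epsilon>) \<le> \<epsilon>) \<and>
    (\<lambda>\<epsilon>. real (k' \<epsilon>)) \<in> O[at_right 0](\<lambda>\<epsilon>. 1 / \<epsilon> ^ 3)"
proof -
  define N where "N \<epsilon> = nat \<lceil>(C / \<epsilon>) ^ 3\<rceil> + 1" for \<epsilon> :: real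
  have N1: "N \<epsilon> \<ge> 1" for \<epsilon> by (simp add: N_def)
  have Nge: "C * real (N \<epsilon>) powr (- 1 / 3) \<le> \<epsilon>" if \<epsilon>: "\<epsilon> > 0" for \<epsilon>
  proof -
    have le: "(C / \<epsilon>) ^ 3 \<le> real (N \<epsilon>)"
      using real_nat_ceiling_ge[of "(C / \<epsilon>) ^ 3"] by (simp add: N_def)
    have "(C / \<epsilon>) ^ 3 \<le> (real (N \<epsilon>) powr (1 / 3)) ^ 3"
      using le N1[of \<epsilon>] by (simp add: powr_powr flip: powr_realpow)
    then have "C / \<epsilon> \<le> real (N \<epsilon>) powr (1 / 3)"
      by (rule power_le_imp_le_base[where n = 2, unfolded numeral_3_eq_3[symmetric] Suc_eq_plus1, simplified])
         simp
    then show ?thesis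
      using \<epsilon> N1[of \<epsilon>] by (simp add: powr_minus field_simps)
  qed
  have "\<forall>\<epsilon>. \<exists>k\<in>{N \<epsilon>..<2 * N \<epsilon>}. Q k \<le> C * real (N \<epsilon>) powr (- 1 / 3)"
    using rate N1 by blast
  then obtain k' where k': "\<And>\<epsilon>. k' \<epsilon> \<in> {N \<epsilon>..<2 * N \<epsilon>}"
      "\<And>\<epsilon>. Q (k' \<epsilon>) \<le> C * real (N \<epsilon>) powr (- 1 / 3)"
    by metis
  have "(\<lambda>\<epsilon>. real (k' \<epsilon>)) \<in> O[at_right 0](\<lambda>\<epsilon>. 1 / \<epsilon> ^ 3)"
  proof (rule bigoI[where c = "2 * C ^ 3 + 4"])
    have "\<forall>\<^sub>F \<epsilon> in at_right 0. \<epsilon> \<in> {0<..<1::real}"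
      by (rule eventually_at_right_real) simp
    then show "\<forall>\<^sub>F \<epsilon> in at_right 0. norm (real (k' \<epsilon>)) \<le> (2 * C ^ 3 + 4) * norm (1 / \<epsilon> ^ 3)"
    proof eventually_elim
      case (elim \<epsilon>)
      have "real (k' \<epsilon>) \<le> 2 * real (N \<epsilon>)" using k'(1)[of \<epsilon>] by simp
      moreover have "real (N \<epsilon>) \<le> (C / \<epsilon>) ^ 3 + 2"
        using of_nat_ceiling[of "(C / \<epsilon>) ^ 3"] C elim
        by (simp add: N_def) linarith
      moreover have "1 \<le> 1 / \<epsilon> ^ 3"
        using elim by (simp add: field_simps power_le_one)
      ultimately have "real (k' \<epsilon>) \<le> 2 * (C / \<epsilon>) ^ 3 + 4 * (1 / \<epsilon> ^ 3)" by linarith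
      then show ?case using elim by (simp add: power_divide add_divide_distrib)
    qed
  qed
  moreover have "k' \<epsilon> \<ge> 1" for \<epsilon> using k'(1)[of \<epsilon>] N1[of \<epsilon>] by simp
  ultimately show ?thesis using k'(2) Nge order_trans by blast
qed

section \<open>Convergence of the smoothing gradient method\<close>

lemma smoothing_param_properties:
  assumes \<rho>: "\<rho> > 0" and k: "k \<ge> 1"
  shows "smoothing_param \<rho> k > 0" "smoothing_param \<rho> k \<le> 1 / (2 * \<rho>)"
    "inverse (smoothing_param \<rho> k) = 2 * \<rho> * real k powr (1 / 3)"
    "smoothing_param \<rho> (Suc k) \<le> smoothing_param \<rho> k"
    "smoothing_param \<rho> k \<le> 2 * smoothing_param \<rho> (Suc k)"
proof -
  show "smoothing_param \<rho> k > 0" using assms by (simp add: smoothing_param_def)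
  have "real k powr (- 1 / 3) \<le> 1 powr (- 1 / 3)" using k by (intro powr_mono2') auto
  then show "smoothing_param \<rho> k \<le> 1 / (2 * \<rho>)"
    using \<rho> by (simp add: smoothing_param_def field_simps)
  show "inverse (smoothing_param \<rho> k) = 2 * \<rho> * real k powr (1 / 3)"
    using assms by (simp add: smoothing_param_def powr_minus field_simps)
  have "real (Suc k) powr (- 1 / 3) \<le> real k powr (- 1 / 3)"
    using k by (intro powr_mono2') auto
  then show "smoothing_param \<rho> (Suc k) \<le> smoothing_param \<rho> k"
    using \<rho> unfolding smoothing_param_def by (intro mult_left_mono) auto
  have "1 / 2 * real k powr (- 1 / 3) \<le> 2 powr (- 1 / 3) * real k powr (- 1 / 3)"
    using powr_mono[of "-1" "- 1 / 3" "2::real"]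
    by (intro mult_right_mono) (auto simp: powr_minus)
  also have "\<dots> = (2 * real k) powr (- 1 / 3)" by (simp add: powr_mult)
  also have "\<dots> \<le> real (Suc k) powr (- 1 / 3)"
    using k by (intro powr_mono2') auto
  finally have "1 / (2 * \<rho>) * (1 / 2 * real k powr (- 1 / 3)) \<le> 1 / (2 * \<rho>) * real (Suc k) powr (- 1 / 3)"
    using \<rho> by (intro mult_left_mono) auto
  then show "smoothing_param \<rho> k \<le> 2 * smoothing_param \<rho> (Suc k)"
    by (simp add: smoothing_param_def field_simps)
qed

text \<open>Every positive index lies in exactly one dyadic epoch, so the epochs amount to a single
  recursion.\<close>

lemma smoothing_gradient_iterates_step:
  assumes "smoothing_gradient_iterates M R f h A \<rho> \<alpha> \<beta> Lf G x" "k \<ge> 1"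
  shows "x (Suc k) = R (x k) (- step_size A \<rho> \<alpha> \<beta> Lf G k *\<^sub>R
    riemannian_gradient M (smoothed_objective f h A \<rho> k) (x k))"
proof -
  obtain l where "2 ^ l \<le> k" "k < 2 ^ (l + 1)"
    using ex_power_ivl1[of 2 k] assms(2) by auto
  then have "k \<in> {2 ^ l..2 ^ (l + 1) - 1}" by auto
  with assms(1) show ?thesis
    unfolding smoothing_gradient_iterates_def Suc_eq_plus1 by blast
qed

theorem theorem4:
  fixes M :: "'a::euclidean_space set"
    and R :: "'a \<Rightarrow> 'a \<Rightarrow> 'a"
    and f :: "'a \<Rightarrow> real"
    and h :: "'b::euclidean_space \<Rightarrow> real"
    and A :: "'a \<Rightarrow> 'b"
    and \<rho> Lf Lh \<alpha> \<beta> G :: real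
    and x :: "nat \<Rightarrow> 'a"
  assumes "compact M" and "embedded_submanifold M"
    and "\<And>y. f differentiable (at y)" and "continuous_on UNIV (gradient f)"
    and "Lf-lipschitz_on UNIV (gradient f)"
    and "\<rho> > 0" and "weakly_convex \<rho> h" and "Lh-lipschitz_on UNIV h"
    and "linear A" and "A \<noteq> (\<lambda>_. 0)"
    and "bdd_below (range (\<lambda>y. f y + h (A y)))"
    and "manifold_retraction M R"
    and "\<alpha> > 0" and "\<beta> > 0"
    and "\<And>y u. y \<in> M \<Longrightarrow> u \<in> tangent_space M y \<Longrightarrow> norm (R y u - y) \<le> \<alpha> * norm u"
    and "\<And>y u. y \<in> M \<Longrightarrow> u \<in> tangent_space M y \<Longrightarrow> norm (R y u - y - u) \<le> \<beta> * (norm u)\<^sup>2"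
    and "\<And>k y. k \<ge> 1 \<Longrightarrow> y \<in> M \<Longrightarrow> norm (gradient (smoothed_objective f h A \<rho> k) y) \<le> G"
    and "surj A"
    and "smoothing_gradient_iterates M R f h A \<rho> \<alpha> \<beta> Lf G x"
  defines "xhat \<equiv> corrected_point h A \<rho> x"
  shows "\<exists>k' :: real \<Rightarrow> nat.
    (\<forall>\<epsilon>>0. k' \<epsilon> \<ge> 1 \<and>
       limiting_subdifferential h (A (xhat (k' \<epsilon>))) \<noteq> {} \<and>
       infdist 0 ((\<lambda>\<zeta>. orth_proj (tangent_space M (x (k' \<epsilon>)))
                         (gradient f (xhat (k' \<epsilon>)) + adjoint A \<zeta>)) `
                  limiting_subdifferential h (A (xhat (k' \<epsilon>)))) \<le> \<epsilon> \<and>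
       norm (x (k' \<epsilon>) - xhat (k' \<epsilon>)) \<le> \<epsilon>) \<and>
    (\<lambda>\<epsilon>. real (k' \<epsilon>)) \<in> O[at_right 0](\<lambda>\<epsilon>. 1 / \<epsilon> ^ 3)"
proof -
  note f_diff = assms(3) and f_lip = assms(5) and \<rho> = assms(6) and wc = assms(7)
    and h_lip = assms(8) and A = assms(9) and A_nz = assms(10) and bdd = assms(11)
    and retr = assms(12) and \<alpha> = assms(13) and \<beta> = assms(14) and R1 = assms(15)
    and R2 = assms(16) and G = assms(17) and surj = assms(18) and iter = assms(19)
  define \<mu> where "\<mu> = smoothing_param \<rho>"
  define F where "F = smoothed_objective f h A \<rho>"
  define \<zeta> where "\<zeta> k = prox_slope h (\<mu> k) (A (x k))" for k
  define T where "T k = tangent_space M (x k)" for k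
  define a where "a k = norm (orth_proj (T k) (gradient f (x k) + adjoint A (\<zeta> k)))" for k
  define B where "B = onorm (right_pinv A)"
  note \<mu>_props = smoothing_param_properties[OF \<rho>, folded \<mu>_def]
  have f_grad: "GDERIV f y :> gradient f y" for y by (rule GDERIV_gradient[OF f_diff])
  have Lf: "Lf \<ge> 0" using f_lip by (rule lipschitz_on_nonneg)
  have Lh: "Lh \<ge> 0" using h_lip by (rule lipschitz_on_nonneg)
  have F_grad: "gradient (F k) y = gradient f y + adjoint A (prox_slope h (\<mu> k) (A y))"
    if k: "k \<ge> 1" for k y
    unfolding F_def smoothed_objective_def[abs_def] \<mu>_def[symmetric]
    by (intro gradient_eqI GDERIV_add f_grad GDERIV_compose_linear A
        GDERIV_moreau_envelope[OF h_lip _ wc \<rho>] \<mu>_props k)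
  have xM: "x k \<in> M" if "k \<ge> 1" for k
    using that
  proof (induction k rule: dec_induct)
    case base
    show ?case using iter by (simp add: smoothing_gradient_iterates_def)
  next
    case (step k)
    let ?g = "riemannian_gradient M (smoothed_objective f h A \<rho> k) (x k)"
    have "- step_size A \<rho> \<alpha> \<beta> Lf G k *\<^sub>R ?g \<in> tangent_space M (x k)"
      using subspace_tangent_space[OF assms(2) step.IH]
      by (intro subspace_scale) (auto simp: riemannian_gradient_def orth_proj_mem_orthogonal)
    then show ?case
      using smoothing_gradient_iterates_step[OF iter step.hyps(1)] retr step.IH
      by (simp add: manifold_retraction_def)
  qed
  have T: "subspace (T k)" if "k \<ge> 1" for k
    unfolding T_def by (rule subspace_tangent_space[OF assms(2) xM[OF that]])
  have G0: "G \<ge> 0" using G[of 1 "x 1"] xM[of 1] norm_ge_zero order_trans by blast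
  have A_pos: "onorm A > 0"
    using onorm_pos_lt[OF linear_conv_bounded_linear[THEN iffD1, OF A]] A_nz by auto

  \<comment> \<open>The second summand pays for all later increases caused by shrinking the smoothing parameter.\<close>
  define P where "P k = F k (x k) + 4 * Lh\<^sup>2 * \<mu> k" for k
  \<comment> \<open>The inverse step size is at most \<open>b * k powr (1 / 3)\<close>.\<close>
  define b where "b = \<alpha>\<^sup>2 * Lf + 2 * G * \<beta> + \<alpha>\<^sup>2 * (onorm A)\<^sup>2 * (2 * \<rho>)"
  have b: "b > 0"
    unfolding b_def using \<alpha> \<beta> \<rho> A_pos G0 Lf by (intro add_nonneg_pos) auto
  have dec: "1 / (2 * b) * real k powr (- 1 / 3) * (a k)\<^sup>2 \<le> P k - P (Suc k)" if k: "k \<ge> 1" for k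
  proof -
    define L where "L = Lf + (onorm A)\<^sup>2 * inverse (\<mu> k)"
    define \<kappa> where "\<kappa> = \<alpha>\<^sup>2 * L + 2 * G * \<beta>"
    define D where "D = gradient f (x k) + adjoint A (\<zeta> k)"
    define u where "u = - (1 / \<kappa>) *\<^sub>R orth_proj (T k) D"
    have \<mu>k: "\<mu> k > 0" by (rule \<mu>_props(1)[OF k])
    have L: "L > 0"
      unfolding L_def using Lf A_pos \<mu>k by (intro add_nonneg_pos) auto
    have \<kappa>: "\<kappa> > 0"
      unfolding \<kappa>_def using L \<alpha> \<beta> G0 by (intro add_pos_nonneg) auto
    have u: "u \<in> T k"
      unfolding u_def using T[OF k] by (intro subspace_scale) (auto simp: orth_proj_mem_orthogonal)
    have "step_size A \<rho> \<alpha> \<beta> Lf G k = 1 / \<kappa>"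
      by (simp add: step_size_def \<kappa>_def L_def \<mu>_def algebra_simps)
    then have step: "x (Suc k) = R (x k) u"
      using smoothing_gradient_iterates_step[OF iter k] F_grad[OF k, of "x k"]
      by (simp add: u_def D_def \<zeta>_def T_def riemannian_gradient_def F_def)
    have "F k (x (Suc k)) \<le> F k (x k) - 1 / (2 * \<kappa>) * (norm (orth_proj (T k) D))\<^sup>2"
    proof (rule retraction_step_decrease[OF T[OF k] _ _ _ \<kappa>_def \<kappa> u_def])
      show "F k (x (Suc k)) \<le> F k (x k) + D \<bullet> (x (Suc k) - x k) + L / 2 * (norm (x (Suc k) - x k))\<^sup>2"
        using smoothed_objective_upper_bound[OF f_grad f_lip h_lip \<mu>k A, of "x (Suc k)" "x k"]
        by (simp add: F_def smoothed_objective_def D_def \<zeta>_def L_def \<mu>_def)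
      show "norm D \<le> G"
        using G[OF k xM[OF k]] F_grad[OF k, of "x k"] by (simp add: D_def F_def \<zeta>_def)
    qed (use L step R1[OF xM[OF k]] R2[OF xM[OF k]] u in \<open>auto simp: T_def\<close>)
    moreover have "F (Suc k) (x (Suc k)) \<le> F k (x (Suc k)) + 4 * Lh\<^sup>2 * (\<mu> k - \<mu> (Suc k))"
      using moreau_envelope_decrease_param[OF h_lip \<mu>_props(1)[of "Suc k"] \<mu>_props(4,5)[OF k], of "A (x (Suc k))"]
      by (simp add: F_def smoothed_objective_def \<mu>_def)
    ultimately have "1 / (2 * \<kappa>) * (a k)\<^sup>2 \<le> P k - P (Suc k)"
      by (simp add: P_def a_def D_def algebra_simps)
    moreover have "1 / (2 * b) * real k powr (- 1 / 3) \<le> 1 / (2 * \<kappa>)"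
    proof -
      have k1: "1 \<le> real k powr (1 / 3)" using k by (intro ge_one_powr_ge_zero) auto
      \<comment> \<open>Only the summand with \<open>inverse (\<mu> k)\<close> grows with \<open>k\<close>; the others are enlarged by \<open>1 \<le> k powr (1 / 3)\<close>.\<close>
      have "\<kappa> = (\<alpha>\<^sup>2 * Lf + 2 * G * \<beta>) * 1 + \<alpha>\<^sup>2 * (onorm A)\<^sup>2 * (2 * \<rho>) * real k powr (1 / 3)"
        by (simp add: \<kappa>_def L_def \<mu>_props(3)[OF k] algebra_simps)
      also have "\<dots> \<le> (\<alpha>\<^sup>2 * Lf + 2 * G * \<beta>) * real k powr (1 / 3)
          + \<alpha>\<^sup>2 * (onorm A)\<^sup>2 * (2 * \<rho>) * real k powr (1 / 3)"
        using k1 \<alpha> \<beta> G0 Lf by (intro add_right_mono mult_left_mono) auto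
      also have "\<dots> = b * real k powr (1 / 3)" by (simp add: b_def algebra_simps)
      finally show ?thesis using \<kappa> b k by (simp add: powr_minus field_simps)
    qed
    ultimately show ?thesis
      using mult_right_mono[of _ "1 / (2 * \<kappa>)" "(a k)\<^sup>2"] order_trans by fastforce
  qed
  obtain m where m: "\<And>y. m \<le> f y + h (A y)" using bdd by (auto simp: bdd_below_def)
  have P_lower: "m \<le> P k" if k: "k \<ge> 1" for k
  proof -
    have "m - 2 * \<mu> k * Lh\<^sup>2 \<le> F k (x k)"
      using m[of "x k"] moreau_envelope_ge[OF h_lip \<mu>_props(1)[OF k], of "A (x k)"]
      by (simp add: F_def smoothed_objective_def \<mu>_def)
    moreover have "0 \<le> 2 * \<mu> k * Lh\<^sup>2" using \<mu>_props(1)[OF k] by simp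
    ultimately show ?thesis by (simp add: P_def algebra_simps)
  qed
  obtain C where C: "C \<ge> 0"
      "\<And>K. K \<ge> 1 \<Longrightarrow> \<exists>k\<in>{K..<2 * K}. a k \<le> C * real K powr (- 1 / 3)"
    by (rule potential_decrease_rate[of "1 / (2 * b)" a P m])
       (use b dec P_lower in \<open>auto simp: a_def\<close>)

  have A_xhat: "A (xhat k) = prox h (\<mu> k) (A (x k))" for k
    by (simp add: xhat_def corrected_point_def linear_diff[OF A] \<mu>_def
        right_pinv_right_inverse(1)[OF A surj])
  have B0: "B \<ge> 0"
    unfolding B_def
    using right_pinv_right_inverse(2)[OF A surj] by (intro onorm_pos_le) (simp add: linear_conv_bounded_linear)
  have dist: "norm (x k - xhat k) \<le> B * Lh / \<rho> * real k powr (- 1 / 3)" if k: "k \<ge> 1" for k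
  proof -
    have "norm (x k - xhat k) \<le> B * norm (A (x k) - prox h (\<mu> k) (A (x k)))"
      using onorm[OF right_pinv_right_inverse(2)[OF A surj, unfolded linear_conv_bounded_linear]]
      by (simp add: xhat_def corrected_point_def B_def \<mu>_def)
    also have "\<dots> \<le> B * (2 * \<mu> k * Lh)"
      using norm_prox_diff_le[OF h_lip \<mu>_props(1)[OF k], of "A (x k)"] B0
      by (intro mult_left_mono) (auto simp: norm_minus_commute)
    finally show ?thesis using \<rho> by (simp add: \<mu>_def smoothing_param_def field_simps)
  qed
  have \<zeta>_mem: "\<zeta> k \<in> limiting_subdifferential h (A (xhat k))" if "k \<ge> 1" for k
    unfolding A_xhat \<zeta>_def
    by (rule prox_slope_limiting_subdifferential[OF h_lip \<mu>_props(1)[OF that]])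
  have infd: "infdist 0 ((\<lambda>\<zeta>. orth_proj (tangent_space M (x k)) (gradient f (xhat k) + adjoint A \<zeta>)) `
      limiting_subdifferential h (A (xhat k))) \<le> a k + Lf * norm (x k - xhat k)" if k: "k \<ge> 1" for k
  proof -
    let ?p = "orth_proj (T k)"
    have "infdist 0 ((\<lambda>\<zeta>. ?p (gradient f (xhat k) + adjoint A \<zeta>)) `
        limiting_subdifferential h (A (xhat k))) \<le> norm (?p (gradient f (xhat k) + adjoint A (\<zeta> k)))"
      unfolding dist_0_norm[symmetric] by (intro infdist_le imageI \<zeta>_mem k)
    also have "gradient f (xhat k) + adjoint A (\<zeta> k)
        = (gradient f (x k) + adjoint A (\<zeta> k)) + (gradient f (xhat k) - gradient f (x k))"
      by simp
    also have "norm (?p \<dots>) \<le> a k + norm (?p (gradient f (xhat k) - gradient f (x k)))"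
      unfolding orth_proj_add[OF T[OF k]] a_def by (rule norm_triangle_ineq)
    also have "norm (?p (gradient f (xhat k) - gradient f (x k))) \<le> norm (gradient f (xhat k) - gradient f (x k))"
      by (rule norm_orth_proj_le[OF T[OF k]])
    also have "\<dots> \<le> Lf * norm (x k - xhat k)"
      using lipschitz_onD[OF f_lip, of "xhat k" "x k"] by (simp add: dist_norm norm_minus_commute)
    finally show ?thesis by (simp add: T_def)
  qed

  \<comment> \<open>The factor \<open>Lf + 1\<close> lets the single quantity \<open>Q k\<close> dominate both the stationarity residual and the distance to the corrected point.\<close>
  define E where "E = (Lf + 1) * (B * Lh / \<rho>)"
  have E: "E \<ge> 0" using Lf B0 Lh \<rho> by (simp add: E_def)
  define Q where "Q k = a k + E * real k powr (- 1 / 3)" for k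
  have bounds: "infdist 0 ((\<lambda>\<zeta>. orth_proj (tangent_space M (x k)) (gradient f (xhat k) + adjoint A \<zeta>)) `
        limiting_subdifferential h (A (xhat k))) \<le> Q k"
      "norm (x k - xhat k) \<le> Q k" if k: "k \<ge> 1" for k
  proof -
    have "(Lf + 1) * norm (x k - xhat k) \<le> E * real k powr (- 1 / 3)"
      unfolding E_def mult.assoc
      using dist[OF k] Lf by (intro mult_left_mono) (auto simp: mult.assoc)
    moreover have "Lf * norm (x k - xhat k) \<ge> 0" using Lf by simp
    moreover have "a k \<ge> 0" by (simp add: a_def)
    ultimately show "infdist 0 ((\<lambda>\<zeta>. orth_proj (tangent_space M (x k)) (gradient f (xhat k) + adjoint A \<zeta>)) `
        limiting_subdifferential h (A (xhat k))) \<le> Q k" "norm (x k - xhat k) \<le> Q k"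
      using infd[OF k] norm_ge_zero[of "x k - xhat k"] unfolding Q_def distrib_right by linarith+
  qed
  have "\<exists>k\<in>{K..<2 * K}. Q k \<le> (C + E) * real K powr (- 1 / 3)" if K: "K \<ge> 1" for K
  proof -
    obtain k where k: "k \<in> {K..<2 * K}" "a k \<le> C * real K powr (- 1 / 3)" using C(2)[OF K] by blast
    moreover have "E * real k powr (- 1 / 3) \<le> E * real K powr (- 1 / 3)"
      using k K E by (intro mult_left_mono powr_mono2') auto
    ultimately show ?thesis by (intro bexI[of _ k]) (auto simp: Q_def distrib_right)
  qed
  then obtain k' :: "real \<Rightarrow> nat" where k': "\<And>\<epsilon>. \<epsilon> > 0 \<Longrightarrow> k' \<epsilon> \<ge> 1 \<and> Q (k' \<epsilon>) \<le> \<epsilon>"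
      "(\<lambda>\<epsilon>. real (k' \<epsilon>)) \<in> O[at_right 0](\<lambda>\<epsilon>. 1 / \<epsilon> ^ 3)"
    using cube_root_rate_imp_complexity[of "C + E" Q] C(1) E by auto
  show ?thesis
  proof (intro exI[of _ k'] conjI allI impI)
    fix \<epsilon> :: real assume "\<epsilon> > 0"
    note k\<epsilon> = k'(1)[OF this]
    show "k' \<epsilon> \<ge> 1" using k\<epsilon> by simp
    show "limiting_subdifferential h (A (xhat (k' \<epsilon>))) \<noteq> {}" using \<zeta>_mem k\<epsilon> by blast
    show "norm (x (k' \<epsilon>) - xhat (k' \<epsilon>)) \<le> \<epsilon>" using bounds(2) k\<epsilon> order_trans by blast
    show "infdist 0 ((\<lambda>\<zeta>. orth_proj (tangent_space M (x (k' \<epsilon>)))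
                         (gradient f (xhat (k' \<epsilon>)) + adjoint A \<zeta>)) `
                  limiting_subdifferential h (A (xhat (k' \<epsilon>)))) \<le> \<epsilon>"
      using bounds(1) k\<epsilon> order_trans by blast
  qed (rule k'(2))
qed

end
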